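(* Suppose $\mathcal{C}$ is a unary operadic category satisfying the blow-up axiom, such that every isomorphism in $\mathcal{C}$ is an automorphism. If the only morphisms in $\mathcal{C}$ with domain a (chosen) local terminal object are identities, then $\mathcal{E}=\bar{\mathcal{C}}^{\mathrm{op}}=\mathrm{sd}(U\mathcal{C})$, equipped with the orthogonal factorization system $(\mathcal{E}_{\mathrm{act}},\mathcal{E}_{\mathrm{int}})$ and with the cardinality functor $\mathcal{E}\to\Gamma$ constant at $\underline{1}$, is a rigid unital hypermoment category. Further, the operadic category associated by Berger's theorem to $\mathcal{E}$ (namely the dual of its active part $\mathcal{E}_{\mathrm{act}}^{\mathrm{op}}$ with its canonical operadic category structure) is $\mathcal{C}$.
   Context: Small categories are identified with their nerves. For a category $\mathcal{C}$, $\mathcal{C}_n$ is the set of chains of $n$ composable morphisms. A local terminal object is an object terminal in its connected component. Unary operadic categories. A category $\mathcal{C}$ is endowed with chosen local terminal objects if a terminal object has been specified in each connected component; $u,u',\dots$ denote chosen local terminal objects, and $\tau_x\colon x\to u$ is the unique map from $x$ to the chosen local terminal object in its component. Let $\mathrm{dec}_\top(\mathcal{C})=\coprod_{x}\mathcal{C}_{/x}$, so $\mathrm{dec}_\top(\mathcal{C})_n=\mathcal{C}_{n+1}$. A unary operadic category is such a $\mathcal{C}$ together with a (fiber) functor $\varphi\colon \mathrm{dec}_\top(\mathcal{C})\to\mathcal{C}$, with components $\varphi_n\colon \mathcal{C}_{n+1}\to\mathcal{C}_n$; $\varphi_0(f)$ is called the fiber of $f$, and for $x\xrightarrow{g}y\xrightarrow{f}z$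 we get $\varphi_1(g\colon fg\to f)\colon\varphi_0(fg)\to\varphi_0(f)$. The axioms are: (U1) $\varphi_0(\mathrm{id}_x)$ is a chosen local terminal object for each $x$; (U2) $\varphi_0(\tau_x)=x$ and $\varphi_1(f\colon\tau_x\to\tau_y)=f$ for each $f\colon x\to y$; (U3) for $a\xrightarrow{h}b\xrightarrow{g}c\xrightarrow{f}x$ one has $\varphi_0(\varphi_1(g\colon fg\to f))=\varphi_0(g)$ and $\varphi_1(h\colon gh\to g)=\varphi_1\bigl(\varphi_1(h\colon fgh\to fg)\colon \varphi_1(gh\colon fgh\to f)\to\varphi_1(g\colon fg\to f)\bigr)$. Blow-up axiom: $\varphi$ is a discrete opfibration, i.e. for every $f\colon a\to x$ in $\mathcal{C}$ and every $p\colon\varphi_0(f)\to z$ in $\mathcal{C}$ there is a unique factorization $f=hk$ with $\varphi_1(k\colon f\to h)=p$. Undecking. $X=U\mathcal{C}$ is the simplicial set with $X_n\subset\mathcal{C}_n$ the set of chains $x_0\to\cdots\to x_{n-1}\to u$ ending in a chosen local terminal object; all face and degeneracy operators are those of the nerve of $\mathcal{C}$, except that the top face $d_n^X\colon X_n\to X_{n-1}$ is $\varphi_{n-1}s_{n-1}d_n$. Edgewise subdivision. $\mathrm{sd}(X)=X\circ Q^{\mathrm{op}}$, where $Q([n])=[n]^{\mathrm{op}}\star[n]\cong[2n+1]$ and for $f\colon[n]\to[m]$: $Q(f)(t)=m-f(n-t)$ if $t\le n$ and $Q(f)(t)=m+1+f(t-n-1)$ if $t\ge n+1$. So $\mathrm{sd}(X)_n=X_{2n+1}$,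 and $\sigma\in X_3$ is a morphism from $d_0d_3\sigma$ to $d_1d_2\sigma$. Under the blow-up axiom $\mathrm{sd}(U\mathcal{C})$ is a category, denoted $\mathcal{E}=\bar{\mathcal{C}}^{\mathrm{op}}$, with the same objects as $\mathcal{C}$ ($x$ corresponding to $\tau_x\in X_1$). Subcategories of $\mathcal{E}$. For $f\colon x\to y$ in $\mathcal{C}$, $f^{\mathrm{op}}\colon y\to x$ in $\mathcal{E}$ is $s_2(x\xrightarrow{f}y\to u)\in X_3$; these form a wide subcategory isomorphic to $\mathcal{C}^{\mathrm{op}}$. For $g\colon x\to z$ in $\mathcal{C}$ with fiber $y$, $[g]\colon y\to x$ in $\mathcal{E}$ is $s_0(x\xrightarrow{g}z\to u)\in X_3$; these form a wide subcategory $\mathcal{F}$ (the category of fiber inclusions). Every morphism of $\mathcal{E}$ is uniquely of the form $[g]\circ f^{\mathrm{op}}$. Set $\mathcal{E}_{\mathrm{act}}=\{[g]\circ f^{\mathrm{op}}\mid [g]\text{ invertible}\}$ (active maps) and $\mathcal{E}_{\mathrm{int}}=\{[g]\circ f^{\mathrm{op}}\mid f^{\mathrm{op}}\text{ invertible}\}$ (inert maps); this is an orthogonal factorization system on $\mathcal{E}$. Hypermoment categories. $\Gamma$ is the opposite of the category of finite pointed sets; a map $\underline{m}\to\underline{n}$ in $\Gamma$ amounts to an $m$-tuple of pairwise disjoint subsets of $\{1,\dots,n\}$, is active if these subsets cover $\{1,\dots,n\}$ and inert if each is a singleton. The data for a hypermoment category are a category $\mathcal{E}$, an active/inert orthogonal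 factorization system $(\mathcal{E}_{\mathrm{act}},\mathcal{E}_{\mathrm{int}})$, and a (cardinality) functor $\gamma\colon\mathcal{E}\to\Gamma$ preserving active and inert maps. An object $x$ is a unit if $\gamma(x)=\underline{1}$ and every active map with codomain $x$ has a unique inert section. The data form a hypermoment category if for each $y\in\mathcal{E}$ and each inert map $\underline{1}\to\gamma(y)$ in $\Gamma$ there is an essentially unique inert lift $x\to y$ with $x$ a unit. It is unital if every object $y$ admits an essentially unique active map $x'\to y$ with $x'$ a unit. It is rigid if every isomorphism is an automorphism and automorphisms act trivially (on the left, i.e. by postcomposition) on active morphisms whose domain is a unit. Associated operadic category (Berger), in the case $\gamma$ constant at $\underline{1}$: for a rigid unital hypermoment category $\mathcal{E}$, the category $\mathcal{E}_{\mathrm{act}}^{\mathrm{op}}$ is a unary operadic category whose chosen local terminal objects are the units. The fiber of a map $x\to z$ of $\mathcal{E}_{\mathrm{act}}^{\mathrm{op}}$, i.e. of an active map $z\to x$, is the object $w$ in the factorization of the composite $v\to z\to x$ ($v\to z$ the essentially unique inert map from a unit) as an active map $v\to w$ followed by an inert map $w\to x$. Given active maps $z\to y\to x$, with inert map $w'\to y$ for the fiber of $z\to y$, the induced map on fibers is the active part $w'\to w$ of the active/inert factorization of $w'\to y\to x$, viewed as a map $w\to w'$ in $\mathcal{E}_{\mathrm{act}}^{\mathrm{op}}$. *)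

theory Defs
  imports Main "HOL-Library.FuncSet"
begin

section \<open>Categories and functors\<close>

text \<open>\<open>Comp C g f\<close> is the composite \<open>g \<circ> f\<close> (first \<open>f\<close>); the operations are relevant
  only on \<open>Ob\<close>, on \<open>Ar\<close> and on composable pairs.\<close>

record ('o, 'a) cat =
  Ob :: "'o set"
  Ar :: "'a set"
  Dom :: "'a \<Rightarrow> 'o"
  Cod :: "'a \<Rightarrow> 'o"
  Id :: "'o \<Rightarrow> 'a"
  Comp :: "'a \<Rightarrow> 'a \<Rightarrow> 'a"

definition category :: "('o, 'a, 'z) cat_scheme \<Rightarrow> bool" where
  "category C \<longleftrightarrow>
     (\<forall>f\<in>Ar C. Dom C f \<in> Ob C \<and> Cod C f \<in> Ob C) \<and>
     (\<forall>x\<in>Ob C. Id C x \<in> Ar C \<and> Dom C (Id C x) = x \<and> Cod C (Id C x) = x) \<and>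
     (\<forall>f\<in>Ar C. \<forall>g\<in>Ar C. Dom C g = Cod C f \<longrightarrow>
        Comp C g f \<in> Ar C \<and> Dom C (Comp C g f) = Dom C f \<and> Cod C (Comp C g f) = Cod C g) \<and>
     (\<forall>f\<in>Ar C. Comp C f (Id C (Dom C f)) = f \<and> Comp C (Id C (Cod C f)) f = f) \<and>
     (\<forall>f\<in>Ar C. \<forall>g\<in>Ar C. \<forall>h\<in>Ar C. Dom C g = Cod C f \<longrightarrow> Dom C h = Cod C g \<longrightarrow>
        Comp C h (Comp C g f) = Comp C (Comp C h g) f)"

definition hom :: "('o, 'a, 'z) cat_scheme \<Rightarrow> 'o \<Rightarrow> 'o \<Rightarrow> 'a set" where
  "hom C x y = {f \<in> Ar C. Dom C f = x \<and> Cod C f = y}"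

definition iso_arrow :: "('o, 'a, 'z) cat_scheme \<Rightarrow> 'a \<Rightarrow> bool" where
  "iso_arrow C f \<longleftrightarrow> f \<in> Ar C \<and>
     (\<exists>g \<in> hom C (Cod C f) (Dom C f).
        Comp C g f = Id C (Dom C f) \<and> Comp C f g = Id C (Cod C f))"

definition isos_are_automorphisms :: "('o, 'a, 'z) cat_scheme \<Rightarrow> bool" where
  "isos_are_automorphisms C \<longleftrightarrow> (\<forall>f. iso_arrow C f \<longrightarrow> Dom C f = Cod C f)"

definition op_cat :: "('o, 'a, 'z) cat_scheme \<Rightarrow> ('o, 'a) cat" where
  "op_cat C = \<lparr> Ob = Ob C, Ar = Ar C, Dom = Cod C, Cod = Dom C, Id = Id C,
                Comp = (\<lambda>g f. Comp C f g) \<rparr>"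

definition cat_functor ::
  "('o, 'a, 'z) cat_scheme \<Rightarrow> ('p, 'b, 'y) cat_scheme \<Rightarrow> ('o \<Rightarrow> 'p) \<Rightarrow> ('a \<Rightarrow> 'b) \<Rightarrow> bool" where
  "cat_functor C D F0 F1 \<longleftrightarrow>
     (\<forall>x\<in>Ob C. F0 x \<in> Ob D \<and> F1 (Id C x) = Id D (F0 x)) \<and>
     (\<forall>f\<in>Ar C. F1 f \<in> Ar D \<and> Dom D (F1 f) = F0 (Dom C f) \<and> Cod D (F1 f) = F0 (Cod C f)) \<and>
     (\<forall>f\<in>Ar C. \<forall>g\<in>Ar C. Dom C g = Cod C f \<longrightarrow> F1 (Comp C g f) = Comp D (F1 g) (F1 f))"

definition cat_isomorphism ::
  "('o, 'a, 'z) cat_scheme \<Rightarrow> ('p, 'b, 'y) cat_scheme \<Rightarrow> ('o \<Rightarrow> 'p) \<Rightarrow> ('a \<Rightarrow> 'b) \<Rightarrow> bool" where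
  "cat_isomorphism C D F0 F1 \<longleftrightarrow>
     cat_functor C D F0 F1 \<and> bij_betw F0 (Ob C) (Ob D) \<and> bij_betw F1 (Ar C) (Ar D)"

definition discrete_opfibration ::
  "('o, 'a, 'z) cat_scheme \<Rightarrow> ('p, 'b, 'y) cat_scheme \<Rightarrow> ('o \<Rightarrow> 'p) \<Rightarrow> ('a \<Rightarrow> 'b) \<Rightarrow> bool" where
  "discrete_opfibration C D F0 F1 \<longleftrightarrow> cat_functor C D F0 F1 \<and>
     (\<forall>x\<in>Ob C. \<forall>p\<in>Ar D. Dom D p = F0 x \<longrightarrow>
        (\<exists>!e. e \<in> Ar C \<and> Dom C e = x \<and> F1 e = p))"

definition connected_in :: "('o, 'a, 'z) cat_scheme \<Rightarrow> 'o \<Rightarrow> 'o \<Rightarrow> bool" where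
  "connected_in C =
     (\<lambda>x y. \<exists>f\<in>Ar C. (Dom C f = x \<and> Cod C f = y) \<or> (Dom C f = y \<and> Cod C f = x))\<^sup>*\<^sup>*"

definition local_terminal :: "('o, 'a, 'z) cat_scheme \<Rightarrow> 'o \<Rightarrow> bool" where
  "local_terminal C u \<longleftrightarrow> u \<in> Ob C \<and>
     (\<forall>x\<in>Ob C. connected_in C x u \<longrightarrow> (\<exists>!f. f \<in> hom C x u))"

text \<open>The coproduct of all slices. The pair \<open>(g, f)\<close> is the arrow \<open>g : fg \<rightarrow> f\<close> in the slice over
  the codomain of \<open>f\<close>.\<close>

definition dec_top :: "('o, 'a, 'z) cat_scheme \<Rightarrow> ('a, 'a \<times> 'a) cat" where
  "dec_top C = \<lparr> Ob = Ar C,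
     Ar = {(g, f). g \<in> Ar C \<and> f \<in> Ar C \<and> Cod C g = Dom C f},
     Dom = (\<lambda>(g, f). Comp C f g),
     Cod = snd,
     Id = (\<lambda>f. (Id C (Dom C f), f)),
     Comp = (\<lambda>(g, f) (g', f'). (Comp C g g', f)) \<rparr>"

section \<open>Unary operadic categories\<close>

text \<open>\<open>Lt\<close> is the set of chosen local terminal objects; \<open>fib0\<close> and \<open>fib1\<close> are the object and arrow
  parts of the fiber functor, so \<open>fib1 C (g, f)\<close> is the map induced by \<open>g : fg \<rightarrow> f\<close>.\<close>

record ('o, 'a) uop = "('o, 'a) cat" +
  Lt :: "'o set"
  fib0 :: "'a \<Rightarrow> 'o"
  fib1 :: "'a \<times> 'a \<Rightarrow> 'a"

definition chosen_local_terminals :: "('o, 'a) uop \<Rightarrow> bool" where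
  "chosen_local_terminals C \<longleftrightarrow>
     (\<forall>u\<in>Lt C. local_terminal C u) \<and>
     (\<forall>x\<in>Ob C. \<exists>!u. u \<in> Lt C \<and> connected_in C x u)"

definition tau :: "('o, 'a) uop \<Rightarrow> 'o \<Rightarrow> 'a" where
  "tau C x = (THE t. t \<in> Ar C \<and> Dom C t = x \<and> Cod C t \<in> Lt C)"

definition unary_operadic_category :: "('o, 'a) uop \<Rightarrow> bool" where
  "unary_operadic_category C \<longleftrightarrow>
     category C \<and> chosen_local_terminals C \<and>
     cat_functor (dec_top C) C (fib0 C) (fib1 C) \<and>
     (\<forall>x\<in>Ob C. fib0 C (Id C x) \<in> Lt C) \<and>
     (\<forall>x\<in>Ob C. fib0 C (tau C x) = x) \<and>
     (\<forall>f\<in>Ar C. fib1 C (f, tau C (Cod C f)) = f) \<and>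
     (\<forall>g\<in>Ar C. \<forall>f\<in>Ar C. Cod C g = Dom C f \<longrightarrow> fib0 C (fib1 C (g, f)) = fib0 C g) \<and>
     (\<forall>h\<in>Ar C. \<forall>g\<in>Ar C. \<forall>f\<in>Ar C. Cod C h = Dom C g \<longrightarrow> Cod C g = Dom C f \<longrightarrow>
        fib1 C (h, g) = fib1 C (fib1 C (h, Comp C f g), fib1 C (g, f)))"

definition blow_up_axiom :: "('o, 'a) uop \<Rightarrow> bool" where
  "blow_up_axiom C \<longleftrightarrow> discrete_opfibration (dec_top C) C (fib0 C) (fib1 C)"

definition uop_isomorphism ::
  "('o, 'a) uop \<Rightarrow> ('p, 'b) uop \<Rightarrow> ('o \<Rightarrow> 'p) \<Rightarrow> ('a \<Rightarrow> 'b) \<Rightarrow> bool" where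
  "uop_isomorphism C D F0 F1 \<longleftrightarrow>
     cat_isomorphism C D F0 F1 \<and>
     F0 ` Lt C = Lt D \<and>
     (\<forall>f\<in>Ar C. F0 (fib0 C f) = fib0 D (F1 f)) \<and>
     (\<forall>g\<in>Ar C. \<forall>f\<in>Ar C. Cod C g = Dom C f \<longrightarrow> F1 (fib1 C (g, f)) = fib1 D (F1 g, F1 f))"

section \<open>Simplicial sets: nerve, undecking, edgewise subdivision\<close>

text \<open>\<open>face X n i : X\<^sub>n \<rightarrow> X\<^sub>n\<^sub>-\<^sub>1\<close> and \<open>degen X n i : X\<^sub>n \<rightarrow> X\<^sub>n\<^sub>+\<^sub>1\<close> are the operators
  \<open>d\<^sub>i\<close> and \<open>s\<^sub>i\<close>.\<close>

record 'x sset =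
  simplices :: "nat \<Rightarrow> 'x set"
  face :: "nat \<Rightarrow> nat \<Rightarrow> 'x \<Rightarrow> 'x"
  degen :: "nat \<Rightarrow> nat \<Rightarrow> 'x \<Rightarrow> 'x"

text \<open>A chain \<open>x\<^sub>0 \<rightarrow> \<dots> \<rightarrow> x\<^sub>n\<close> is encoded as its initial object together with the list of its \<open>n\<close>
  arrows, so that a chain of length 0 is an object.\<close>

type_synonym ('o, 'a) chain = "'o \<times> 'a list"

fun is_path :: "('o, 'a, 'z) cat_scheme \<Rightarrow> 'o \<Rightarrow> 'a list \<Rightarrow> bool" where
  "is_path C x [] \<longleftrightarrow> x \<in> Ob C"
| "is_path C x (f # fs) \<longleftrightarrow> f \<in> Ar C \<and> Dom C f = x \<and> is_path C (Cod C f) fs"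

definition vertex :: "('o, 'a, 'z) cat_scheme \<Rightarrow> nat \<Rightarrow> ('o, 'a) chain \<Rightarrow> 'o" where
  "vertex C i = (\<lambda>(x, fs). if i = 0 then x else Cod C (fs ! (i - 1)))"

definition nerve :: "('o, 'a, 'z) cat_scheme \<Rightarrow> ('o, 'a) chain sset" where
  "nerve C = \<lparr>
     simplices = (\<lambda>n. {(x, fs). length fs = n \<and> is_path C x fs}),
     face = (\<lambda>n i (x, fs).
        if i = 0 then (Cod C (hd fs), tl fs)
        else if i = n then (x, butlast fs)
        else (x, take (i - 1) fs @ Comp C (fs ! i) (fs ! (i - 1)) # drop (i + 1) fs)),
     degen = (\<lambda>n i (x, fs). (x, take i fs @ Id C (vertex C i (x, fs)) # drop i fs)) \<rparr>"

fun chain_comp :: "('o, 'a, 'z) cat_scheme \<Rightarrow> ('o, 'a) chain \<Rightarrow> 'a" where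
  "chain_comp C (x, fs) = foldl (\<lambda>h f. Comp C f h) (Id C x) fs"

text \<open>The identification of \<open>C\<^sub>n\<^sub>+\<^sub>1\<close> with the chains of length \<open>n\<close> in \<^term>\<open>dec_top C\<close>: the vertices
  are the composites \<open>x\<^sub>i \<rightarrow> x\<^sub>n\<^sub>+\<^sub>1\<close> for \<open>i \<le> n\<close>.\<close>

fun dec_chain :: "('o, 'a, 'z) cat_scheme \<Rightarrow> ('o, 'a) chain \<Rightarrow> ('a, 'a \<times> 'a) chain" where
  "dec_chain C (x, fs) =
     (chain_comp C (x, fs),
      map (\<lambda>i. (fs ! i, chain_comp C (Cod C (fs ! i), drop (i + 1) fs))) [0..<length fs - 1])"

text \<open>The component \<open>C\<^sub>n\<^sub>+\<^sub>1 \<rightarrow> C\<^sub>n\<close> of the fiber functor, for all \<open>n\<close>.\<close>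

definition fib_chain :: "('o, 'a) uop \<Rightarrow> ('o, 'a) chain \<Rightarrow> ('o, 'a) chain" where
  "fib_chain C c = map_prod (fib0 C) (map (fib1 C)) (dec_chain C c)"

definition undecking :: "('o, 'a) uop \<Rightarrow> ('o, 'a) chain sset" where
  "undecking C = \<lparr>
     simplices = (\<lambda>n. {c \<in> simplices (nerve C) n. vertex C n c \<in> Lt C}),
     face = (\<lambda>n i. if i = n
        then fib_chain C \<circ> degen (nerve C) (n - 1) (n - 1) \<circ> face (nerve C) n n
        else face (nerve C) n i),
     degen = degen (nerve C) \<rparr>"

text \<open>The functor \<open>Q\<close> on a monotone map \<open>f : [n] \<rightarrow> [m]\<close>, and its effect on the generating
  cofaces and codegeneracies, which determines the operators of the edgewise subdivision.\<close>

definition edgewise_Q :: "nat \<Rightarrow> nat \<Rightarrow> (nat \<Rightarrow> nat) \<Rightarrow> nat \<Rightarrow> nat" where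
  "edgewise_Q n m f t = (if t \<le> n then m - f (n - t) else m + 1 + f (t - n - 1))"

definition coface :: "nat \<Rightarrow> nat \<Rightarrow> nat" where
  "coface i t = (if t < i then t else t + 1)"

definition codegen :: "nat \<Rightarrow> nat \<Rightarrow> nat" where
  "codegen i t = (if t \<le> i then t else t - 1)"

lemma edgewise_Q_coface:
  assumes "i \<le> n" "0 < n" "t \<le> 2 * n - 1"
  shows "edgewise_Q (n - 1) n (coface i) t = (coface (n + 1 + i) \<circ> coface (n - i)) t"
  using assms by (auto simp: edgewise_Q_def coface_def)

lemma edgewise_Q_codegen:
  assumes "i \<le> n" "t \<le> 2 * n + 3"
  shows "edgewise_Q (n + 1) n (codegen i) t = (codegen (n + 1 + i) \<circ> codegen (n - i)) t"
  using assms by (auto simp: edgewise_Q_def codegen_def)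

definition sd :: "'x sset \<Rightarrow> 'x sset" where
  "sd X = \<lparr>
     simplices = (\<lambda>n. simplices X (2 * n + 1)),
     face = (\<lambda>n i. face X (2 * n) (n - i) \<circ> face X (2 * n + 1) (n + 1 + i)),
     degen = (\<lambda>n i. degen X (2 * n + 2) (n - i) \<circ> degen X (2 * n + 1) (n + 1 + i)) \<rparr>"

text \<open>The category whose nerve is the given simplicial set, when there is one: an arrow goes from
  its face \<open>d\<^sub>1\<close> to its face \<open>d\<^sub>0\<close>, and composites are read off from the unique 2-simplex with
  the prescribed outer faces.\<close>

definition cat_of_sset :: "'x sset \<Rightarrow> ('x, 'x) cat" where
  "cat_of_sset S = \<lparr>
     Ob = simplices S 0,
     Ar = simplices S 1,
     Dom = face S 1 1,
     Cod = face S 1 0,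
     Id = degen S 0 0,
     Comp = (\<lambda>g f. face S 2 1 (THE s. s \<in> simplices S 2 \<and> face S 2 2 s = f \<and> face S 2 0 s = g)) \<rparr>"

section \<open>Hypermoment categories\<close>

definition orthogonal_factorization_system ::
  "('o, 'a, 'z) cat_scheme \<Rightarrow> 'a set \<Rightarrow> 'a set \<Rightarrow> bool" where
  "orthogonal_factorization_system E L R \<longleftrightarrow>
     L \<subseteq> Ar E \<and> R \<subseteq> Ar E \<and>
     (\<forall>a. iso_arrow E a \<longrightarrow> a \<in> L \<and> a \<in> R) \<and>
     (\<forall>f\<in>L. \<forall>g\<in>L. Dom E g = Cod E f \<longrightarrow> Comp E g f \<in> L) \<and>
     (\<forall>f\<in>R. \<forall>g\<in>R. Dom E g = Cod E f \<longrightarrow> Comp E g f \<in> R) \<and>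
     (\<forall>f\<in>Ar E. \<exists>l\<in>L. \<exists>r\<in>R. Dom E r = Cod E l \<and> Comp E r l = f) \<and>
     (\<forall>l\<in>L. \<forall>r\<in>R. \<forall>l'\<in>L. \<forall>r'\<in>R.
        Dom E r = Cod E l \<longrightarrow> Dom E r' = Cod E l' \<longrightarrow> Comp E r l = Comp E r' l' \<longrightarrow>
        (\<exists>!a. iso_arrow E a \<and> a \<in> hom E (Cod E l) (Cod E l') \<and>
              Comp E a l = l' \<and> Comp E r' a = r))"

text \<open>The skeletal category of finite pointed sets: the object \<open>n\<close> stands for \<open>{0..n}\<close> with base
  point \<open>0\<close>, and the arrow \<open>(n, m, f)\<close> is a pointed map \<open>f\<close> from \<open>{0..n}\<close> to \<open>{0..m}\<close>.\<close>

type_synonym pointed_map = "nat \<times> nat \<times> (nat \<Rightarrow> nat)"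

definition fin_pointed :: "(nat, pointed_map) cat" where
  "fin_pointed = \<lparr> Ob = UNIV,
     Ar = {(n, m, f). f \<in> {0..n} \<rightarrow>\<^sub>E {0..m} \<and> f 0 = 0},
     Dom = (\<lambda>(n, m, f). n),
     Cod = (\<lambda>(n, m, f). m),
     Id = (\<lambda>n. (n, n, restrict id {0..n})),
     Comp = (\<lambda>(m', p, g) (n, m, f). (n, p, compose {0..n} g f)) \<rparr>"

definition Gamma :: "(nat, pointed_map) cat" where
  "Gamma = op_cat fin_pointed"

text \<open>The tuple of pairwise disjoint subsets of \<open>{1..n}\<close> described by an arrow \<open>m \<rightarrow> n\<close> of
  \<^term>\<open>Gamma\<close>, indexed by \<open>i \<in> {1..m}\<close>.\<close>

definition Gamma_subset :: "pointed_map \<Rightarrow> nat \<Rightarrow> nat set" where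
  "Gamma_subset = (\<lambda>(n, m, f) i. {j \<in> {1..n}. f j = i})"

definition Gamma_active :: "pointed_map set" where
  "Gamma_active = {e \<in> Ar Gamma. (\<Union>i\<in>{1..Dom Gamma e}. Gamma_subset e i) = {1..Cod Gamma e}}"

definition Gamma_inert :: "pointed_map set" where
  "Gamma_inert = {e \<in> Ar Gamma. \<forall>i\<in>{1..Dom Gamma e}. \<exists>j. Gamma_subset e i = {j}}"

text \<open>A category with active and inert maps and a cardinality functor \<open>(card0, card1)\<close>.\<close>

record ('o, 'a) hypermoment_data = "('o, 'a) cat" +
  Active :: "'a set"
  Inert :: "'a set"
  card0 :: "'o \<Rightarrow> nat"
  card1 :: "'a \<Rightarrow> pointed_map"

definition is_unit :: "('o, 'a) hypermoment_data \<Rightarrow> 'o \<Rightarrow> bool" where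
  "is_unit E x \<longleftrightarrow> x \<in> Ob E \<and> card0 E x = 1 \<and>
     (\<forall>f\<in>Active E. Cod E f = x \<longrightarrow>
        (\<exists>!s. s \<in> Inert E \<and> s \<in> hom E x (Dom E f) \<and> Comp E f s = Id E x))"

text \<open>Existence, and uniqueness up to unique isomorphism over the common codomain of the arrows
  satisfying \<open>P\<close>.\<close>

definition essentially_unique :: "('o, 'a, 'z) cat_scheme \<Rightarrow> ('a \<Rightarrow> bool) \<Rightarrow> bool" where
  "essentially_unique E P \<longleftrightarrow> (\<exists>i. P i) \<and>
     (\<forall>i j. P i \<longrightarrow> P j \<longrightarrow>
        (\<exists>!a. iso_arrow E a \<and> a \<in> hom E (Dom E i) (Dom E j) \<and> Comp E j a = i))"

definition hypermoment_category :: "('o, 'a) hypermoment_data \<Rightarrow> bool" where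
  "hypermoment_category E \<longleftrightarrow>
     category E \<and>
     orthogonal_factorization_system E (Active E) (Inert E) \<and>
     cat_functor E Gamma (card0 E) (card1 E) \<and>
     (\<forall>f\<in>Active E. card1 E f \<in> Gamma_active) \<and>
     (\<forall>f\<in>Inert E. card1 E f \<in> Gamma_inert) \<and>
     (\<forall>y\<in>Ob E. \<forall>e\<in>Gamma_inert. e \<in> hom Gamma 1 (card0 E y) \<longrightarrow>
        essentially_unique E
          (\<lambda>i. i \<in> Inert E \<and> is_unit E (Dom E i) \<and> Cod E i = y \<and> card1 E i = e))"

definition unital :: "('o, 'a) hypermoment_data \<Rightarrow> bool" where
  "unital E \<longleftrightarrow> (\<forall>y\<in>Ob E.
     essentially_unique E (\<lambda>f. f \<in> Active E \<and> is_unit E (Dom E f) \<and> Cod E f = y))"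

definition rigid :: "('o, 'a) hypermoment_data \<Rightarrow> bool" where
  "rigid E \<longleftrightarrow> isos_are_automorphisms E \<and>
     (\<forall>f\<in>Active E. is_unit E (Dom E f) \<longrightarrow>
        (\<forall>a. iso_arrow E a \<and> a \<in> hom E (Cod E f) (Cod E f) \<longrightarrow> Comp E a f = f))"

section \<open>The operadic category associated to a rigid unital hypermoment category\<close>

text \<open>The structure is described for constant cardinality 1. Factorizations and inert maps out of
  units are only essentially unique, so representatives are selected by choice.\<close>

definition factorization :: "('o, 'a) hypermoment_data \<Rightarrow> 'a \<Rightarrow> 'a \<times> 'a" where
  "factorization E f =
     (SOME (l, r). l \<in> Active E \<and> r \<in> Inert E \<and> Dom E r = Cod E l \<and> Comp E r l = f)"

definition active_part :: "('o, 'a) hypermoment_data \<Rightarrow> 'a \<Rightarrow> 'a" where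
  "active_part E f = fst (factorization E f)"

definition inert_part :: "('o, 'a) hypermoment_data \<Rightarrow> 'a \<Rightarrow> 'a" where
  "inert_part E f = snd (factorization E f)"

definition unit_inclusion :: "('o, 'a) hypermoment_data \<Rightarrow> 'o \<Rightarrow> 'a" where
  "unit_inclusion E z = (SOME i. i \<in> Inert E \<and> is_unit E (Dom E i) \<and> Cod E i = z)"

text \<open>For an active map \<open>f : z \<rightarrow> x\<close>, the inert map into \<open>x\<close> whose domain is the fiber.\<close>

definition fiber_inert :: "('o, 'a) hypermoment_data \<Rightarrow> 'a \<Rightarrow> 'a" where
  "fiber_inert E f = inert_part E (Comp E f (unit_inclusion E (Dom E f)))"

definition active_op :: "('o, 'a) hypermoment_data \<Rightarrow> ('o, 'a) cat" where
  "active_op E = op_cat \<lparr> Ob = Ob E, Ar = Active E, Dom = Dom E, Cod = Cod E, Id = Id E,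
                          Comp = Comp E \<rparr>"

text \<open>An arrow \<open>(g, f)\<close> of \<^term>\<open>dec_top (active_op E)\<close> consists of active maps \<open>f : z \<rightarrow> y\<close> and
  \<open>g : y \<rightarrow> x\<close> of \<open>E\<close>.\<close>

definition associated_operadic_category :: "('o, 'a) hypermoment_data \<Rightarrow> ('o, 'a) uop" where
  "associated_operadic_category E = cat.extend (active_op E) (uop.fields
     {x. is_unit E x}
     (\<lambda>f. Dom E (fiber_inert E f))
     (\<lambda>(g, f). active_part E (Comp E g (fiber_inert E f))))"

section \<open>The hypermoment structure on the edgewise subdivision\<close>

definition sdU :: "('o, 'a) uop \<Rightarrow> (('o, 'a) chain, ('o, 'a) chain) cat" where
  "sdU C = cat_of_sset (sd (undecking C))"

text \<open>The object, the arrow \<open>f\<^sup>o\<^sup>p\<close> and the fiber inclusion \<open>[g]\<close> of \<^term>\<open>sdU C\<close> given by an object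
  \<open>x\<close> and arrows \<open>f\<close>, \<open>g\<close> of \<open>C\<close>.\<close>

definition obj :: "('o, 'a) uop \<Rightarrow> 'o \<Rightarrow> ('o, 'a) chain" where
  "obj C x = (x, [tau C x])"

definition op_arrow :: "('o, 'a) uop \<Rightarrow> 'a \<Rightarrow> ('o, 'a) chain" where
  "op_arrow C f = degen (undecking C) 2 2 (Dom C f, [f, tau C (Cod C f)])"

definition fib_inclusion :: "('o, 'a) uop \<Rightarrow> 'a \<Rightarrow> ('o, 'a) chain" where
  "fib_inclusion C g = degen (undecking C) 2 0 (Dom C g, [g, tau C (Cod C g)])"

definition sdU_act :: "('o, 'a) uop \<Rightarrow> ('o, 'a) chain set" where
  "sdU_act C = {Comp (sdU C) (fib_inclusion C g) (op_arrow C f) |g f.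
     g \<in> Ar C \<and> f \<in> Ar C \<and> Dom C f = fib0 C g \<and> iso_arrow (sdU C) (fib_inclusion C g)}"

definition sdU_int :: "('o, 'a) uop \<Rightarrow> ('o, 'a) chain set" where
  "sdU_int C = {Comp (sdU C) (fib_inclusion C g) (op_arrow C f) |g f.
     g \<in> Ar C \<and> f \<in> Ar C \<and> Dom C f = fib0 C g \<and> iso_arrow (sdU C) (op_arrow C f)}"

definition sdU_hypermoment ::
  "('o, 'a) uop \<Rightarrow> (('o, 'a) chain, ('o, 'a) chain) hypermoment_data" where
  "sdU_hypermoment C = cat.extend (sdU C) (hypermoment_data.fields
     (sdU_act C) (sdU_int C) (\<lambda>_. 1) (\<lambda>_. Id Gamma 1))"

end

theory Submission
  imports Defs
begin

text \<open>An arrow of \<^term>\<open>sdU C\<close> is a composable pair \<open>x \<rightarrow> y \<rightarrow> z\<close> of arrows \<open>f, g\<close>, seen as a map from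
  the fiber of \<open>g\<close> to \<open>x\<close>; it is both \<open>f\<^sup>o\<^sup>p \<circ> [g]\<close> and \<open>[gf] \<circ> p\<^sup>o\<^sup>p\<close>, where \<open>p\<close> is the map of fibers
  induced by \<open>f\<close> over \<open>g\<close>. By the blow-up axiom, a composable pair of such arrows amounts to a
  chain \<open>a, b, c, d\<close> in \<open>C\<close>, and axiom (U3) gives associativity.

  If only identities start at chosen local terminal objects, then an arrow whose fiber is such an
  object is an identity: it and the identity of its domain are both lifts of the same identity.
  The fiber of an isomorphism is isomorphic to, hence equal to, a chosen local terminal object, so
  all isomorphisms of \<open>C\<close>, and then all isomorphisms of \<^term>\<open>sdU C\<close>, are identities. Thus the
  active maps are exactly the \<open>f\<^sup>o\<^sup>p\<close>, the inert maps are exactly the \<open>[g]\<close>, and every essentially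
  unique object in the hypermoment axioms and in Berger's construction is strictly unique.\<close>

section \<open>The category structure of the edgewise subdivision\<close>

text \<open>These are the 3-simplices of \<open>undecking C\<close>: the last arrow is forced to be
  \<open>tau\<close>, so the pair \<open>f, g\<close> carries all the data.\<close>

definition sd_arrow :: "('o, 'a) uop \<Rightarrow> 'a \<Rightarrow> 'a \<Rightarrow> ('o, 'a) chain" where
  "sd_arrow C f g = (Dom C f, [f, g, tau C (Cod C g)])"

locale blow_up =
  fixes C :: "('o, 'a) uop"
  assumes uop: "unary_operadic_category C"
    and blow_up: "blow_up_axiom C"
begin

abbreviation comp_C (infixr "\<cdot>" 70) where "g \<cdot> f \<equiv> Comp C g f"
abbreviation "E \<equiv> sdU C"

section \<open>The axioms of a unary operadic category as rewrite rules\<close>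

lemma category_C: "category C"
  using uop by (simp add: unary_operadic_category_def)

lemma Dom_Ob [simp]: "f \<in> Ar C \<Longrightarrow> Dom C f \<in> Ob C"
  and Cod_Ob [simp]: "f \<in> Ar C \<Longrightarrow> Cod C f \<in> Ob C"
  and Id_Ar [simp]: "x \<in> Ob C \<Longrightarrow> Id C x \<in> Ar C"
  and Dom_Id [simp]: "x \<in> Ob C \<Longrightarrow> Dom C (Id C x) = x"
  and Cod_Id [simp]: "x \<in> Ob C \<Longrightarrow> Cod C (Id C x) = x"
  and comp_Id [simp]: "f \<in> Ar C \<Longrightarrow> Dom C f = x \<Longrightarrow> f \<cdot> Id C x = f"
  and Id_comp [simp]: "f \<in> Ar C \<Longrightarrow> Cod C f = x \<Longrightarrow> Id C x \<cdot> f = f"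
  and comp_Ar [simp]: "\<lbrakk>f \<in> Ar C; g \<in> Ar C; Cod C f = Dom C g\<rbrakk> \<Longrightarrow> g \<cdot> f \<in> Ar C"
  and Dom_comp [simp]: "\<lbrakk>f \<in> Ar C; g \<in> Ar C; Cod C f = Dom C g\<rbrakk> \<Longrightarrow> Dom C (g \<cdot> f) = Dom C f"
  and Cod_comp [simp]: "\<lbrakk>f \<in> Ar C; g \<in> Ar C; Cod C f = Dom C g\<rbrakk> \<Longrightarrow> Cod C (g \<cdot> f) = Cod C g"
  using category_C unfolding category_def by auto

lemma comp_assoc [simp]:
  "\<lbrakk>f \<in> Ar C; g \<in> Ar C; h \<in> Ar C; Cod C f = Dom C g; Cod C g = Dom C h\<rbrakk>
    \<Longrightarrow> (h \<cdot> g) \<cdot> f = h \<cdot> (g \<cdot> f)"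
  using category_C unfolding category_def by (metis (no_types))

lemma fib_functor: "cat_functor (dec_top C) C (fib0 C) (fib1 C)"
  using uop by (simp add: unary_operadic_category_def)

lemma fib0_Ob [simp]: "f \<in> Ar C \<Longrightarrow> fib0 C f \<in> Ob C"
  and fib1_Id [simp]: "\<lbrakk>f \<in> Ar C; Dom C f = x\<rbrakk> \<Longrightarrow> fib1 C (Id C x, f) = Id C (fib0 C f)"
  using fib_functor unfolding cat_functor_def by (auto simp: dec_top_def)

lemma fib1_Ar [simp]: "\<lbrakk>g \<in> Ar C; f \<in> Ar C; Cod C g = Dom C f\<rbrakk> \<Longrightarrow> fib1 C (g, f) \<in> Ar C"
  and Dom_fib1 [simp]:
    "\<lbrakk>g \<in> Ar C; f \<in> Ar C; Cod C g = Dom C f\<rbrakk> \<Longrightarrow> Dom C (fib1 C (g, f)) = fib0 C (f \<cdot> g)"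
  and Cod_fib1 [simp]:
    "\<lbrakk>g \<in> Ar C; f \<in> Ar C; Cod C g = Dom C f\<rbrakk> \<Longrightarrow> Cod C (fib1 C (g, f)) = fib0 C f"
proof -
  assume "g \<in> Ar C" "f \<in> Ar C" "Cod C g = Dom C f"
  then have "(g, f) \<in> Ar (dec_top C)" by (simp add: dec_top_def)
  with fib_functor show "fib1 C (g, f) \<in> Ar C" "Dom C (fib1 C (g, f)) = fib0 C (f \<cdot> g)"
    "Cod C (fib1 C (g, f)) = fib0 C f"
    unfolding cat_functor_def by (simp_all add: dec_top_def)
qed

lemma fib1_comp:
  assumes "h \<in> Ar C" "g \<in> Ar C" "f \<in> Ar C" "Cod C h = Dom C g" "Cod C g = Dom C f"
  shows "fib1 C (g \<cdot> h, f) = fib1 C (g, f) \<cdot> fib1 C (h, f \<cdot> g)"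
proof -
  have "(h, f \<cdot> g) \<in> Ar (dec_top C)" "(g, f) \<in> Ar (dec_top C)"
    "Dom (dec_top C) (g, f) = Cod (dec_top C) (h, f \<cdot> g)"
    "Comp (dec_top C) (g, f) (h, f \<cdot> g) = (g \<cdot> h, f)"
    using assms by (simp_all add: dec_top_def)
  with fib_functor show ?thesis unfolding cat_functor_def by metis
qed

lemma fib0_fib1 [simp]:
  "\<lbrakk>g \<in> Ar C; f \<in> Ar C; Cod C g = Dom C f\<rbrakk> \<Longrightarrow> fib0 C (fib1 C (g, f)) = fib0 C g"
  using uop by (simp add: unary_operadic_category_def)

lemma fib1_fib1:
  "\<lbrakk>h \<in> Ar C; g \<in> Ar C; f \<in> Ar C; Cod C h = Dom C g; Cod C g = Dom C f\<rbrakk>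
    \<Longrightarrow> fib1 C (fib1 C (h, f \<cdot> g), fib1 C (g, f)) = fib1 C (h, g)"
  using uop by (simp add: unary_operadic_category_def)

lemma fib0_Id_Lt [simp]: "x \<in> Ob C \<Longrightarrow> fib0 C (Id C x) \<in> Lt C"
  and fib0_tau [simp]: "x \<in> Ob C \<Longrightarrow> fib0 C (tau C x) = x"
  and fib1_tau [simp]: "\<lbrakk>f \<in> Ar C; Cod C f = y\<rbrakk> \<Longrightarrow> fib1 C (f, tau C y) = f"
  using uop by (auto simp: unary_operadic_category_def)

lemma Lt_Ob [simp]: "u \<in> Lt C \<Longrightarrow> u \<in> Ob C"
  using uop by (auto simp: unary_operadic_category_def chosen_local_terminals_def local_terminal_def)

text \<open>An arrow from \<open>x\<close> to a chosen local terminal object connects the two, so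
  its codomain is the object chosen in the component of \<open>x\<close>, and terminality leaves one
  arrow. This makes the description in \<open>tau\<close> meaningful.\<close>

lemma ex1_arrow_to_Lt:
  assumes x: "x \<in> Ob C"
  shows "\<exists>!t. t \<in> Ar C \<and> Dom C t = x \<and> Cod C t \<in> Lt C"
proof -
  have terminal: "\<exists>!f. f \<in> hom C x u" if "u \<in> Lt C" "connected_in C x u" for u
    using that x uop
    by (simp add: unary_operadic_category_def chosen_local_terminals_def local_terminal_def)
  have "\<exists>!u. u \<in> Lt C \<and> connected_in C x u"
    using x uop by (simp add: unary_operadic_category_def chosen_local_terminals_def)
  moreover have "connected_in C x (Cod C t)" if "t \<in> Ar C" "Dom C t = x" for t
    unfolding connected_in_def using that by (intro r_into_rtranclp) auto
  ultimately show ?thesis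
    using terminal unfolding hom_def mem_Collect_eq by metis
qed

lemma tau_Ar [simp]: "x \<in> Ob C \<Longrightarrow> tau C x \<in> Ar C"
  and Dom_tau [simp]: "x \<in> Ob C \<Longrightarrow> Dom C (tau C x) = x"
  and Cod_tau [simp]: "x \<in> Ob C \<Longrightarrow> Cod C (tau C x) \<in> Lt C"
  using theI'[OF ex1_arrow_to_Lt] unfolding tau_def by blast+

lemma eq_tau: "\<lbrakk>t \<in> Ar C; Dom C t = x; Cod C t \<in> Lt C\<rbrakk> \<Longrightarrow> t = tau C x"
  by (metis Dom_Ob ex1_arrow_to_Lt tau_Ar Dom_tau Cod_tau)

lemma tau_Lt [simp]: "u \<in> Lt C \<Longrightarrow> tau C u = Id C u"
  by (metis Cod_Id Dom_Id Id_Ar Lt_Ob eq_tau)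

lemma fib0_Id_Lt_eq [simp]: "u \<in> Lt C \<Longrightarrow> fib0 C (Id C u) = u"
  by (metis Lt_Ob fib0_tau tau_Lt)

lemma tau_comp [simp]:
  "\<lbrakk>f \<in> Ar C; Cod C f = y\<rbrakk> \<Longrightarrow> tau C y \<cdot> f = tau C (Dom C f)"
  by (rule eq_tau) auto

text \<open>By (U1) the fiber of \<open>Id C y\<close> lies in \<open>Lt C\<close>, and only
  \<open>tau\<close> leads there.\<close>

lemma fib1_to_Id [simp]: "\<lbrakk>f \<in> Ar C; Cod C f = y\<rbrakk> \<Longrightarrow> fib1 C (f, Id C y) = tau C (fib0 C f)"
  by (rule eq_tau) auto

section \<open>Unique lifting along the fiber functor\<close>

lemma fib_lift_ex1:
  assumes "f \<in> Ar C" "p \<in> Ar C" "Dom C p = fib0 C f"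
  shows "\<exists>!e. e \<in> Ar (dec_top C) \<and> Dom (dec_top C) e = f \<and> fib1 C e = p"
  using assms blow_up unfolding blow_up_axiom_def discrete_opfibration_def
  by (simp add: dec_top_def)

lemma fib_lift:
  assumes "f \<in> Ar C" "p \<in> Ar C" "Dom C p = fib0 C f"
  obtains h k where "h \<in> Ar C" "k \<in> Ar C" "Cod C h = Dom C k" "f = k \<cdot> h" "p = fib1 C (h, k)"
proof -
  from fib_lift_ex1[OF assms] obtain e
    where "e \<in> Ar (dec_top C)" "Dom (dec_top C) e = f" "fib1 C e = p" by blast
  with that[of "fst e" "snd e"] show ?thesis by (auto simp: dec_top_def)
qed

lemma fib_lift_unique:
  assumes "h \<in> Ar C" "k \<in> Ar C" "Cod C h = Dom C k"
    and "h' \<in> Ar C" "k' \<in> Ar C" "Cod C h' = Dom C k'"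
    and "k \<cdot> h = k' \<cdot> h'" "fib1 C (h, k) = fib1 C (h', k')"
  shows "h = h' \<and> k = k'"
proof -
  have "\<exists>!e. e \<in> Ar (dec_top C) \<and> Dom (dec_top C) e = k \<cdot> h \<and> fib1 C e = fib1 C (h, k)"
    by (rule fib_lift_ex1) (use assms in simp_all)
  moreover have "(h, k) \<in> Ar (dec_top C)" "Dom (dec_top C) (h, k) = k \<cdot> h"
    "(h', k') \<in> Ar (dec_top C)" "Dom (dec_top C) (h', k') = k \<cdot> h"
    using assms by (simp_all add: dec_top_def)
  ultimately have "(h, k) = (h', k')" using assms(8) by metis
  then show ?thesis by simp
qed

section \<open>Low-dimensional simplices of the undecking\<close>

lemma simplices_undecking_1:
  "simplices (undecking C) 1 = obj C ` Ob C"
  by (auto simp: undecking_def nerve_def vertex_def obj_def length_Suc_conv image_iff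
      intro: eq_tau)

lemma simplices_undecking_3:
  "simplices (undecking C) 3 = {sd_arrow C f g |f g. f \<in> Ar C \<and> g \<in> Ar C \<and> Cod C f = Dom C g}"
  by (auto simp: undecking_def nerve_def vertex_def sd_arrow_def length_Suc_conv numeral_eq_Suc
      intro: eq_tau)

lemma simplices_undecking_5:
  "simplices (undecking C) 5 = {(Dom C a, [a, b, c, d, tau C (Cod C d)]) |a b c d.
     a \<in> Ar C \<and> b \<in> Ar C \<and> c \<in> Ar C \<and> d \<in> Ar C \<and>
     Cod C a = Dom C b \<and> Cod C b = Dom C c \<and> Cod C c = Dom C d}"
  by (auto simp: undecking_def nerve_def vertex_def length_Suc_conv numeral_eq_Suc
      intro: eq_tau)

section \<open>Faces and composition in \<open>sdU C\<close>\<close>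

lemma Ob_E: "Ob E = obj C ` Ob C"
  using simplices_undecking_1 by (simp add: sdU_def cat_of_sset_def sd_def)

lemma Ar_E: "Ar E = {sd_arrow C f g |f g. f \<in> Ar C \<and> g \<in> Ar C \<and> Cod C f = Dom C g}"
  using simplices_undecking_3 by (simp add: sdU_def cat_of_sset_def sd_def numeral_eq_Suc)

lemma Id_E [simp]: "x \<in> Ob C \<Longrightarrow> Id E (obj C x) = sd_arrow C (Id C x) (tau C x)"
  by (simp add: sdU_def cat_of_sset_def sd_def undecking_def nerve_def vertex_def obj_def
      sd_arrow_def)

lemma E_arrow [simp]:
  assumes "f \<in> Ar C" "g \<in> Ar C" "Cod C f = Dom C g"
  shows "sd_arrow C f g \<in> Ar E" "Dom E (sd_arrow C f g) = obj C (fib0 C g)"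
    "Cod E (sd_arrow C f g) = obj C (Dom C f)"
  using assms
  by (auto simp: Ar_E)
    (simp_all add: sdU_def cat_of_sset_def sd_def undecking_def nerve_def vertex_def obj_def
      sd_arrow_def fib_chain_def numeral_eq_Suc)

text \<open>Only face 2 involves the top face \<open>d_5\<close> of the undecking. It replaces each
  arrow by its induced map between fibers of the maps to \<open>Cod C d\<close>; the appended
  identity turns \<open>d\<close> into the final \<open>tau\<close>.\<close>

lemma sd_faces:
  assumes "a \<in> Ar C" "b \<in> Ar C" "c \<in> Ar C" "d \<in> Ar C"
    "Cod C a = Dom C b" "Cod C b = Dom C c" "Cod C c = Dom C d"
  defines "s \<equiv> (Dom C a, [a, b, c, d, tau C (Cod C d)])"
  shows "face (sd (undecking C)) 2 0 s = sd_arrow C a (d \<cdot> c \<cdot> b)"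
    "face (sd (undecking C)) 2 1 s = sd_arrow C (b \<cdot> a) c"
    "face (sd (undecking C)) 2 2 s = sd_arrow C (fib1 C (b, d \<cdot> c)) (fib1 C (c, d))"
  using assms
  by (simp_all add: sd_def undecking_def nerve_def vertex_def
      sd_arrow_def fib_chain_def numeral_eq_Suc upt_rec)

lemma sd_arrow_eq_iff [simp]: "sd_arrow C f g = sd_arrow C f' g' \<longleftrightarrow> f = f' \<and> g = g'"
  by (auto simp: sd_arrow_def)

lemma obj_eq_iff [simp]: "obj C x = obj C y \<longleftrightarrow> x = y"
  by (auto simp: obj_def)

text \<open>The composite is the middle face of the 2-simplex \<open>a, b, c, d\<close>; the point
  is that its outer faces determine this chain.\<close>

lemma Comp_E:
  assumes "a \<in> Ar C" "b \<in> Ar C" "c \<in> Ar C" "d \<in> Ar C"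
    "Cod C a = Dom C b" "Cod C b = Dom C c" "Cod C c = Dom C d"
  shows "Comp E (sd_arrow C a (d \<cdot> c \<cdot> b)) (sd_arrow C (fib1 C (b, d \<cdot> c)) (fib1 C (c, d)))
    = sd_arrow C (b \<cdot> a) c"
proof -
  let ?S = "sd (undecking C)"
  let ?s = "(Dom C a, [a, b, c, d, tau C (Cod C d)])"
  let ?P = "\<lambda>s. s \<in> simplices ?S 2
    \<and> face ?S 2 2 s = sd_arrow C (fib1 C (b, d \<cdot> c)) (fib1 C (c, d))
    \<and> face ?S 2 0 s = sd_arrow C a (d \<cdot> c \<cdot> b)"
  have S: "simplices ?S 2 = simplices (undecking C) 5" by (simp add: sd_def)
  have "(THE s. ?P s) = ?s"
  proof (rule the_equality)
    show "?P ?s" using assms sd_faces[OF assms] unfolding S simplices_undecking_5 by auto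
  next
    fix s assume s: "?P s"
    then obtain a' b' c' d' where s': "s = (Dom C a', [a', b', c', d', tau C (Cod C d')])"
      and ch: "a' \<in> Ar C" "b' \<in> Ar C" "c' \<in> Ar C" "d' \<in> Ar C"
        "Cod C a' = Dom C b'" "Cod C b' = Dom C c'" "Cod C c' = Dom C d'"
      unfolding S simplices_undecking_5 by auto
    have eqs: "a' = a" "d' \<cdot> c' \<cdot> b' = d \<cdot> c \<cdot> b" "fib1 C (b', d' \<cdot> c') = fib1 C (b, d \<cdot> c)"
      "fib1 C (c', d') = fib1 C (c, d)"
      using s sd_faces[OF ch] by (simp_all add: s')
    \<comment> \<open>Unique lifting is applied twice: first to
      \<open>d \<cdot> c \<cdot> b\<close>, which splits off \<open>b\<close>, then to
      \<open>d \<cdot> c\<close>, which splits off \<open>c\<close>.\<close>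
    have "b' = b \<and> d' \<cdot> c' = d \<cdot> c"
      by (rule fib_lift_unique) (use ch assms eqs in auto)
    moreover from this have "c' = c \<and> d' = d"
      by (intro fib_lift_unique) (use ch assms eqs in auto)
    ultimately show "s = ?s" using s' eqs by simp
  qed
  then show ?thesis
    using sd_faces(2)[OF assms] by (simp add: sdU_def cat_of_sset_def)
qed

text \<open>This is the existence of the filling 2-simplex. The first arrow of \<open>p\<close>
  starts at the fiber of the second arrow of \<open>q\<close> and lifts there, splitting off
  \<open>b\<close>; the second arrow of \<open>p\<close> then lifts along the remaining factor,
  giving \<open>c\<close> and \<open>d\<close>.\<close>

lemma composable_E:
  assumes "p \<in> Ar E" "q \<in> Ar E" "Dom E q = Cod E p"
  obtains a b c d where "a \<in> Ar C" "b \<in> Ar C" "c \<in> Ar C" "d \<in> Ar C"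
    "Cod C a = Dom C b" "Cod C b = Dom C c" "Cod C c = Dom C d"
    "p = sd_arrow C (fib1 C (b, d \<cdot> c)) (fib1 C (c, d))" "q = sd_arrow C a (d \<cdot> c \<cdot> b)"
proof -
  from assms obtain f g where p: "p = sd_arrow C f g" "f \<in> Ar C" "g \<in> Ar C" "Cod C f = Dom C g"
    by (auto simp: Ar_E)
  from assms obtain a g' where q: "q = sd_arrow C a g'" "a \<in> Ar C" "g' \<in> Ar C" "Cod C a = Dom C g'"
    by (auto simp: Ar_E)
  have "Dom C f = fib0 C g'" using assms p q by simp
  with p q obtain b k where bk: "b \<in> Ar C" "k \<in> Ar C" "Cod C b = Dom C k" "g' = k \<cdot> b"
    "f = fib1 C (b, k)" by (metis fib_lift)
  then have "Dom C g = fib0 C k" using p by simp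
  with p bk obtain c d where cd: "c \<in> Ar C" "d \<in> Ar C" "Cod C c = Dom C d" "k = d \<cdot> c"
    "g = fib1 C (c, d)" by (metis fib_lift)
  show thesis by (rule that[of a b c d]) (use p q bk cd in auto)
qed

lemma Comp_E_closed:
  assumes "p \<in> Ar E" "q \<in> Ar E" "Dom E q = Cod E p"
  shows "Comp E q p \<in> Ar E \<and> Dom E (Comp E q p) = Dom E p \<and> Cod E (Comp E q p) = Cod E q"
  using assms by (rule composable_E) (simp add: Comp_E)

text \<open>Both bracketings of three arrows are read off from one chain \<open>a, b, b', c', d', d\<close> in \<open>C\<close>.\<close>

lemma Comp_E_assoc:
  assumes p: "p \<in> Ar E" and q: "q \<in> Ar E" and r: "r \<in> Ar E"
    and qp: "Dom E q = Cod E p" and rq: "Dom E r = Cod E q"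
  shows "Comp E r (Comp E q p) = Comp E (Comp E r q) p"
proof -
  from q r rq obtain a b k d where
    ch: "a \<in> Ar C" "b \<in> Ar C" "k \<in> Ar C" "d \<in> Ar C"
      "Cod C a = Dom C b" "Cod C b = Dom C k" "Cod C k = Dom C d"
    and qr: "q = sd_arrow C (fib1 C (b, d \<cdot> k)) (fib1 C (k, d))" "r = sd_arrow C a (d \<cdot> k \<cdot> b)"
    by (rule composable_E)
  have rq': "Comp E r q = sd_arrow C (b \<cdot> a) k"
    unfolding qr using ch by (rule Comp_E)
  then have "sd_arrow C (b \<cdot> a) k \<in> Ar E" "Dom E (sd_arrow C (b \<cdot> a) k) = Cod E p"
    using Comp_E_closed[OF q r rq] qp by auto
  with p obtain a' b' c' d' where
    ch': "a' \<in> Ar C" "b' \<in> Ar C" "c' \<in> Ar C" "d' \<in> Ar C"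
      "Cod C a' = Dom C b'" "Cod C b' = Dom C c'" "Cod C c' = Dom C d'"
    and p': "p = sd_arrow C (fib1 C (b', d' \<cdot> c')) (fib1 C (c', d'))"
    and "sd_arrow C (b \<cdot> a) k = sd_arrow C a' (d' \<cdot> c' \<cdot> b')"
    by (rule composable_E)
  then have k: "a' = b \<cdot> a" "k = d' \<cdot> c' \<cdot> b'" by simp_all
  have *: "Cod C b = Dom C b'" "Cod C d' = Dom C d" using ch ch' k by simp_all
  \<comment> \<open>These maps between fibers over \<open>Cod C d\<close>, preceded by
    \<open>fib1 C (b, d \<cdot> k)\<close>, form the chain that represents the pair
    \<open>p\<close>, \<open>q\<close>.\<close>
  let ?b = "fib1 C (b', d \<cdot> d' \<cdot> c')" and ?c = "fib1 C (c', d \<cdot> d')" and ?d = "fib1 C (d', d)"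
  have d_c: "?d \<cdot> ?c = fib1 C (d' \<cdot> c', d)"
    using ch ch' * by (simp add: fib1_comp)
  have d_c_b: "?d \<cdot> ?c \<cdot> ?b = fib1 C (k, d)"
    using ch ch' * k fib1_comp[of b' "d' \<cdot> c'" d] by (simp add: fib1_comp)
  \<comment> \<open>By (U3), fibers taken inside the fibers over \<open>Cod C d\<close> agree with
    those taken directly in \<open>C\<close>, so the new chain has \<open>p\<close> as its
    face.\<close>
  have "fib1 C (?b, ?d \<cdot> ?c) = fib1 C (b', d' \<cdot> c')"
    unfolding d_c using ch ch' * fib1_fib1[of b' "d' \<cdot> c'" d] by simp
  moreover have "fib1 C (?c, ?d) = fib1 C (c', d')"
    using ch ch' * fib1_fib1[of c' d' d] by simp
  ultimately have "Comp E q p = sd_arrow C (?b \<cdot> fib1 C (b, d \<cdot> k)) ?c"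
    using Comp_E[of "fib1 C (b, d \<cdot> k)" ?b ?c ?d] ch ch' * k d_c_b by (simp add: qr p')
  moreover have "?b \<cdot> fib1 C (b, d \<cdot> k) = fib1 C (b' \<cdot> b, (d \<cdot> d') \<cdot> c')"
    using ch ch' * k by (simp add: fib1_comp)
  ultimately have "Comp E r (Comp E q p) = sd_arrow C ((b' \<cdot> b) \<cdot> a) c'"
    using Comp_E[of a "b' \<cdot> b" c' "d \<cdot> d'"] ch ch' * k by (simp add: qr)
  also have "\<dots> = Comp E (Comp E r q) p"
    unfolding rq' p' k using Comp_E[of "b \<cdot> a" b' c' d'] ch ch' * by simp
  finally show ?thesis .
qed

text \<open>The chain is \<open>f, p, q, tau\<close>: by (U2), passing to fibers over a chosen local
  terminal object leaves \<open>p\<close> and \<open>q\<close> unchanged.\<close>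

lemma Comp_op_arrow [simp]:
  assumes "f \<in> Ar C" "p \<in> Ar C" "q \<in> Ar C" "Cod C f = Dom C p" "Cod C p = Dom C q" "y = Dom C p"
  shows "Comp E (sd_arrow C f (tau C y)) (sd_arrow C p q) = sd_arrow C (p \<cdot> f) q"
  using Comp_E[of f p q "tau C (Cod C q)"] assms by simp

text \<open>The chain is \<open>Id, b, k, Id\<close>: the final identity turns \<open>k\<close> into
  \<open>tau\<close>.\<close>

lemma Comp_fib_inclusion [simp]:
  assumes "b \<in> Ar C" "k \<in> Ar C" "Cod C b = Dom C k" "x = Dom C b" "y = fib0 C k"
  shows "Comp E (sd_arrow C (Id C x) (k \<cdot> b)) (sd_arrow C (fib1 C (b, k)) (tau C y))
    = sd_arrow C b k"
  using Comp_E[of "Id C x" b k "Id C (Cod C k)"] assms by simp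

lemma category_E: "category E"
proof -
  have "Dom E p \<in> Ob E \<and> Cod E p \<in> Ob E" if "p \<in> Ar E" for p
    using that by (auto simp: Ar_E Ob_E)
  moreover have "Comp E p (Id E (Dom E p)) = p \<and> Comp E (Id E (Cod E p)) p = p"
    if p: "p \<in> Ar E" for p
  proof -
    from p obtain f g where p: "p = sd_arrow C f g" and fg: "f \<in> Ar C" "g \<in> Ar C" "Cod C f = Dom C g"
      by (auto simp: Ar_E)
    \<comment> \<open>The chain is \<open>f, Id, g, Id\<close>: on fibers the middle identity stays
      an identity, and the final one turns \<open>g\<close> into \<open>tau\<close>.\<close>
    have "Comp E p (Id E (Dom E p)) = p"
      using fg Comp_E[of f "Id C (Dom C g)" g "Id C (Cod C g)"] by (simp add: p)
    moreover have "Comp E (Id E (Cod E p)) p = p"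
      using fg by (simp add: p)
    ultimately show ?thesis ..
  qed
  ultimately show ?thesis
    unfolding category_def using Comp_E_closed Comp_E_assoc by (auto simp: Ob_E)
qed

lemma Comp_E_Id:
  assumes "e \<in> Ar E"
  shows "Comp E e (Id E (Dom E e)) = e" "Comp E (Id E (Cod E e)) e = e"
  using category_E assms unfolding category_def by auto

lemma op_arrow_eq: "f \<in> Ar C \<Longrightarrow> op_arrow C f = sd_arrow C f (tau C (Cod C f))"
  by (simp add: op_arrow_def sd_arrow_def undecking_def nerve_def vertex_def numeral_eq_Suc)

lemma fib_inclusion_eq: "g \<in> Ar C \<Longrightarrow> fib_inclusion C g = sd_arrow C (Id C (Dom C g)) g"
  by (simp add: fib_inclusion_def sd_arrow_def undecking_def nerve_def vertex_def)

lemma Comp_fib_inclusion_op_arrow: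
  assumes "b \<in> Ar C" "k \<in> Ar C" "Cod C b = Dom C k"
  shows "Comp E (fib_inclusion C (k \<cdot> b)) (op_arrow C (fib1 C (b, k))) = sd_arrow C b k"
  using assms by (simp add: op_arrow_eq fib_inclusion_eq)

text \<open>Lifting \<open>f\<close> along \<open>g\<close> turns the composite into a pair
  \<open>b, k\<close>, which is determined as an arrow of \<open>E\<close> and gives back
  \<open>g\<close> as \<open>k \<cdot> b\<close> and \<open>f\<close> as
  \<open>fib1 C (b, k)\<close>.\<close>

lemma fib_op_factorization_unique:
  assumes "g \<in> Ar C" "f \<in> Ar C" "Dom C f = fib0 C g"
    and "g' \<in> Ar C" "f' \<in> Ar C" "Dom C f' = fib0 C g'"
    and eq: "Comp E (fib_inclusion C g) (op_arrow C f) = Comp E (fib_inclusion C g') (op_arrow C f')"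
  shows "g = g' \<and> f = f'"
proof -
  from assms obtain b k where bk: "b \<in> Ar C" "k \<in> Ar C" "Cod C b = Dom C k" "g = k \<cdot> b"
    "f = fib1 C (b, k)" by (metis fib_lift)
  from assms obtain b' k' where bk': "b' \<in> Ar C" "k' \<in> Ar C" "Cod C b' = Dom C k'" "g' = k' \<cdot> b'"
    "f' = fib1 C (b', k')" by (metis fib_lift)
  from eq have "sd_arrow C b k = sd_arrow C b' k'"
    using bk bk' by (simp add: Comp_fib_inclusion_op_arrow)
  with bk bk' show ?thesis by simp
qed

end

section \<open>Isomorphisms, active and inert maps\<close>

text \<open>When all isomorphisms are identities, the only possible comparison is an identity;
  essential uniqueness is thus obtained from strict uniqueness.\<close>

lemma essentially_unique_eq:
  assumes "category D" and iso: "\<And>a. iso_arrow D a \<Longrightarrow> a = Id D (Dom D a)" and "i \<in> Ar D"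
  shows "essentially_unique D (\<lambda>j. j = i)"
proof -
  have "Id D (Dom D i) \<in> hom D (Dom D i) (Dom D i)" "Comp D i (Id D (Dom D i)) = i"
    "Comp D (Id D (Dom D i)) (Id D (Dom D i)) = Id D (Dom D i)"
    using assms(1) \<open>i \<in> Ar D\<close> unfolding category_def hom_def by auto (metis+)
  then have Id: "iso_arrow D (Id D (Dom D i))" "Id D (Dom D i) \<in> hom D (Dom D i) (Dom D i)"
    "Comp D i (Id D (Dom D i)) = i"
    unfolding iso_arrow_def hom_def by auto
  have "\<exists>!a. iso_arrow D a \<and> a \<in> hom D (Dom D i) (Dom D i) \<and> Comp D i a = i"
    by (rule ex1I[of _ "Id D (Dom D i)"]) (use Id in \<open>auto dest: iso simp: hom_def\<close>)
  then show ?thesis unfolding essentially_unique_def by simp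
qed

locale blow_up_rigid = blow_up +
  assumes from_Lt: "\<lbrakk>f \<in> Ar C; Dom C f \<in> Lt C\<rbrakk> \<Longrightarrow> f = Id C (Dom C f)"
begin

abbreviation "H \<equiv> sdU_hypermoment C"

section \<open>Invertible arrows are identities\<close>

lemma eq_Id_if_fib0_Lt:
  assumes "k \<in> Ar C" "fib0 C k \<in> Lt C"
  shows "k = Id C (Dom C k)"
  \<comment> \<open>In \<open>dec_top C\<close> both \<open>(k, Id)\<close> and
    \<open>(Id, k)\<close> start at \<open>k\<close>. The first is sent to \<open>tau\<close> of
    \<open>fib0 C k\<close>, which is an identity because \<open>fib0 C k\<close> is in
    \<open>Lt C\<close>.\<close>
  using fib_lift_unique[of k "Id C (Cod C k)" "Id C (Dom C k)" k] assms by simp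

text \<open>The map of fibers induced by \<open>g\<close> over \<open>f\<close> starts at the fiber
  of an identity, so it is itself an identity and the fiber of \<open>f\<close> lies in
  \<open>Lt C\<close>.\<close>

lemma iso_C_eq_Id:
  assumes "f \<in> Ar C" "g \<in> Ar C" "Cod C f = Dom C g" "Cod C g = Dom C f"
    "f \<cdot> g = Id C (Cod C f)"
  shows "f = Id C (Dom C f)"
proof (rule eq_Id_if_fib0_Lt)
  have "fib1 C (g, f) \<in> Ar C" "Dom C (fib1 C (g, f)) = fib0 C (Id C (Cod C f))"
    "Cod C (fib1 C (g, f)) = fib0 C f"
    using assms by simp_all
  with from_Lt[of "fib1 C (g, f)"] show "fib0 C f \<in> Lt C"
    using assms by (metis Cod_Id Cod_Ob fib0_Id_Lt fib0_Ob Id_Ar)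
qed fact

text \<open>The pair is represented by a chain \<open>a, b, c, d\<close> whose last three arrows
  compose to \<open>g\<close>. An identity as composite forces \<open>b\<close> to be an identity
  and \<open>c\<close> to be \<open>tau\<close>; then \<open>d\<close> starts in \<open>Lt C\<close>
  and is an identity too.\<close>

lemma split_epi_fib_inclusion:
  assumes "g \<in> Ar C" "s \<in> Ar E" "Cod E s = obj C (fib0 C g)"
    and "Comp E (fib_inclusion C g) s = Id E (obj C (Dom C g))"
  shows "g = tau C (Dom C g)"
proof -
  have "fib_inclusion C g \<in> Ar E" "Dom E (fib_inclusion C g) = Cod E s"
    using assms by (simp_all add: fib_inclusion_eq)
  with assms(2) obtain a b c d where
    ch: "a \<in> Ar C" "b \<in> Ar C" "c \<in> Ar C" "d \<in> Ar C"
      "Cod C a = Dom C b" "Cod C b = Dom C c" "Cod C c = Dom C d"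
    and s: "s = sd_arrow C (fib1 C (b, d \<cdot> c)) (fib1 C (c, d))"
    and g: "fib_inclusion C g = sd_arrow C a (d \<cdot> c \<cdot> b)"
    by (rule composable_E)
  have g': "a = Id C (Dom C g)" "g = d \<cdot> c \<cdot> b"
    using g assms(1) unfolding fib_inclusion_eq[OF assms(1)] sd_arrow_eq_iff by metis+
  have "sd_arrow C (b \<cdot> a) c = Id E (obj C (Dom C g))"
    using assms(4) unfolding s g Comp_E[OF ch] .
  then have "b = Id C (Dom C g)" "c = tau C (Dom C g)"
    using assms(1) ch g'(1) by auto
  moreover from this have "d = Id C (Dom C d)" using ch assms(1)
    by (intro from_Lt) (auto simp flip: ch(7))
  ultimately show ?thesis using ch g' assms(1) by (metis comp_Id Id_comp Dom_tau Dom_Ob)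
qed

lemma iso_E_eq_Id:
  assumes "iso_arrow E e"
  shows "e = Id E (Dom E e)"
proof -
  from assms obtain s where e: "e \<in> Ar E" and s: "s \<in> Ar E" "Dom E s = Cod E e" "Cod E s = Dom E e"
    and inv: "Comp E s e = Id E (Dom E e)" "Comp E e s = Id E (Cod E e)"
    unfolding iso_arrow_def hom_def by auto
  from e obtain f g where e': "e = sd_arrow C f g" and fg: "f \<in> Ar C" "g \<in> Ar C" "Cod C f = Dom C g"
    by (auto simp: Ar_E)
  \<comment> \<open>Since \<open>e\<close> is the inclusion
    \<open>fib_inclusion C (g \<cdot> f)\<close> after \<open>?p\<close>, the composite of
    \<open>?p\<close> after \<open>s\<close> is a section of that inclusion.\<close>
  let ?p = "op_arrow C (fib1 C (f, g))"
  have "Comp E (fib_inclusion C (g \<cdot> f)) (Comp E ?p s) = Id E (Cod E e)"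
    using Comp_E_assoc[of s ?p "fib_inclusion C (g \<cdot> f)"] inv(2) s fg
    by (simp add: e' Comp_fib_inclusion_op_arrow fib_inclusion_eq op_arrow_eq)
  moreover have "Comp E ?p s \<in> Ar E \<and> Cod E (Comp E ?p s) = Cod E ?p"
    using Comp_E_closed[of s ?p] s fg by (simp add: e' op_arrow_eq)
  ultimately have "g \<cdot> f = tau C (Dom C f)"
    using split_epi_fib_inclusion[of "g \<cdot> f" "Comp E ?p s"] fg by (simp add: e' op_arrow_eq)
  then have "Cod C g \<in> Lt C" using fg by (metis Cod_comp Cod_tau Dom_Ob)
  then have "g = tau C (Cod C f)" using fg by (intro eq_tau) auto
  \<comment> \<open>From here \<open>e\<close> is \<open>op_arrow C f\<close>. Its inverse turns out
    to have the same form, and comparing both composites with identities inverts \<open>f\<close> in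
    \<open>C\<close>.\<close>
  with e' have e_op: "e = sd_arrow C f (tau C (Cod C f))" by simp
  obtain p q where pq: "s = sd_arrow C p q" "p \<in> Ar C" "q \<in> Ar C" "Cod C p = Dom C q"
    using s by (auto simp: Ar_E)
  have p: "Dom C p = Cod C f" using s(3) fg(1) pq by (simp add: e_op)
  then have "Comp E e s = sd_arrow C (p \<cdot> f) q" using fg(1) pq by (simp add: e_op)
  then have pf: "p \<cdot> f = Id C (Dom C f)" and q: "q = tau C (Dom C f)"
    using inv(2) fg(1) by (simp_all add: e_op)
  have p': "Cod C p = Dom C f" using pq q fg(1) by simp
  then have "Comp E s e = sd_arrow C (f \<cdot> p) (tau C (Cod C f))"
    using fg(1) pq(2) p by (simp add: e_op pq(1) q)
  then have "f \<cdot> p = Id C (Cod C f)" using inv(1) fg(1) by (simp add: e_op)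
  then have "f = Id C (Dom C f)"
    using iso_C_eq_Id[of f p] fg(1) pq(2) p p' by simp
  moreover from this have "Cod C f = Dom C f" using fg(1) by (metis Cod_Id Dom_Ob)
  ultimately show ?thesis using fg(1) by (simp add: e_op)
qed

lemma iso_E_iff: "iso_arrow E e \<longleftrightarrow> (\<exists>x\<in>Ob C. e = Id E (obj C x))"
proof
  assume e: "iso_arrow E e"
  then have "Dom E e \<in> Ob E" using category_E by (simp add: iso_arrow_def category_def)
  with iso_E_eq_Id[OF e] show "\<exists>x\<in>Ob C. e = Id E (obj C x)" by (auto simp: Ob_E)
next
  assume "\<exists>x\<in>Ob C. e = Id E (obj C x)"
  then obtain x where x: "x \<in> Ob C" "e = Id E (obj C x)" by blast
  then have "e \<in> Ar E" "Dom E e = obj C x" "Cod E e = obj C x" by simp_all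
  moreover from x this have "Comp E e e = Id E (obj C x)" by simp
  ultimately show "iso_arrow E e" using x(2)
    unfolding iso_arrow_def hom_def by (intro conjI bexI[of _ e]) (simp_all del: Id_E)
qed

lemma iso_fib_inclusion_iff:
  assumes "g \<in> Ar C"
  shows "iso_arrow E (fib_inclusion C g) \<longleftrightarrow> g = tau C (Dom C g)"
  unfolding iso_E_iff using assms
  by (auto simp: fib_inclusion_eq intro!: bexI[of _ "Dom C g"])

lemma iso_op_arrow_iff:
  assumes "f \<in> Ar C"
  shows "iso_arrow E (op_arrow C f) \<longleftrightarrow> f = Id C (Dom C f)"
proof
  assume "iso_arrow E (op_arrow C f)"
  then show "f = Id C (Dom C f)" using assms by (auto simp: iso_E_iff op_arrow_eq)
next
  assume f: "f = Id C (Dom C f)"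
  then have "Cod C f = Dom C f" using assms by (metis Cod_Id Dom_Ob)
  with f assms have "op_arrow C f = Id E (obj C (Dom C f))" by (simp add: op_arrow_eq)
  then show "iso_arrow E (op_arrow C f)" using assms by (auto simp: iso_E_iff)
qed

section \<open>Description of the active and inert maps\<close>

lemma fib_inclusion_tau_comp:
  assumes "f \<in> Ar C"
  shows "Comp E (fib_inclusion C (tau C (Dom C f))) (op_arrow C f) = op_arrow C f"
  using Comp_fib_inclusion_op_arrow[of f "tau C (Cod C f)"] assms by (simp add: op_arrow_eq)

lemma op_Id_comp:
  assumes "g \<in> Ar C"
  shows "Comp E (fib_inclusion C g) (op_arrow C (Id C (fib0 C g))) = fib_inclusion C g"
  using Comp_fib_inclusion_op_arrow[of "Id C (Dom C g)" g] assms by (simp add: fib_inclusion_eq)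

lemma sdU_act_eq: "sdU_act C = op_arrow C ` Ar C"
proof
  show "sdU_act C \<subseteq> op_arrow C ` Ar C"
  proof
    fix e assume "e \<in> sdU_act C"
    then obtain g f where "e = Comp E (fib_inclusion C g) (op_arrow C f)" "g \<in> Ar C" "f \<in> Ar C"
      "Dom C f = fib0 C g" "g = tau C (Dom C g)"
      unfolding sdU_act_def using iso_fib_inclusion_iff by blast
    then have "e = op_arrow C f" by (metis Dom_Ob fib0_tau fib_inclusion_tau_comp)
    then show "e \<in> op_arrow C ` Ar C" using \<open>f \<in> Ar C\<close> by blast
  qed
  show "op_arrow C ` Ar C \<subseteq> sdU_act C"
  proof
    fix e assume "e \<in> op_arrow C ` Ar C"
    then obtain f where f: "f \<in> Ar C" "e = op_arrow C f" by blast
    then show "e \<in> sdU_act C" unfolding sdU_act_def mem_Collect_eq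
      by (intro exI[of _ "tau C (Dom C f)"] exI[of _ f])
        (simp add: fib_inclusion_tau_comp iso_fib_inclusion_iff)
  qed
qed

lemma sdU_int_eq: "sdU_int C = fib_inclusion C ` Ar C"
proof
  show "sdU_int C \<subseteq> fib_inclusion C ` Ar C"
  proof
    fix e assume "e \<in> sdU_int C"
    then obtain g f where "e = Comp E (fib_inclusion C g) (op_arrow C f)" "g \<in> Ar C" "f \<in> Ar C"
      "Dom C f = fib0 C g" "f = Id C (Dom C f)"
      unfolding sdU_int_def using iso_op_arrow_iff by blast
    then have "e = fib_inclusion C g" by (metis op_Id_comp)
    then show "e \<in> fib_inclusion C ` Ar C" using \<open>g \<in> Ar C\<close> by blast
  qed
  show "fib_inclusion C ` Ar C \<subseteq> sdU_int C"
  proof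
    fix e assume "e \<in> fib_inclusion C ` Ar C"
    then obtain g where g: "g \<in> Ar C" "e = fib_inclusion C g" by blast
    then show "e \<in> sdU_int C" unfolding sdU_int_def mem_Collect_eq
      by (intro exI[of _ g] exI[of _ "Id C (fib0 C g)"]) (simp add: op_Id_comp iso_op_arrow_iff)
  qed
qed

lemma H_simps [simp]:
  "Ob H = Ob E" "Ar H = Ar E" "Dom H = Dom E" "Cod H = Cod E" "Id H = Id E" "Comp H = Comp E"
  "Active H = op_arrow C ` Ar C" "Inert H = fib_inclusion C ` Ar C"
  "card0 H x = 1" "card1 H e = Id Gamma 1"
  by (simp_all add: sdU_hypermoment_def cat.defs hypermoment_data.defs sdU_act_eq sdU_int_eq)

lemma iso_H [simp]: "iso_arrow H = iso_arrow E"
  by (simp add: iso_arrow_def hom_def fun_eq_iff)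

lemma hom_H [simp]: "hom H = hom E"
  by (simp add: hom_def fun_eq_iff)

lemma category_H: "category H"
  using category_E by (simp add: category_def)

lemma op_arrow_E [simp]:
  assumes "f \<in> Ar C"
  shows "op_arrow C f \<in> Ar E" "Dom E (op_arrow C f) = obj C (Cod C f)"
    "Cod E (op_arrow C f) = obj C (Dom C f)"
  using assms by (simp_all add: op_arrow_eq)

lemma fib_inclusion_E [simp]:
  assumes "g \<in> Ar C"
  shows "fib_inclusion C g \<in> Ar E" "Dom E (fib_inclusion C g) = obj C (fib0 C g)"
    "Cod E (fib_inclusion C g) = obj C (Dom C g)"
  using assms by (simp_all add: fib_inclusion_eq)

lemma op_arrow_Id: "x \<in> Ob C \<Longrightarrow> op_arrow C (Id C x) = Id E (obj C x)"
  by (simp add: op_arrow_eq)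

lemma op_arrow_comp:
  "\<lbrakk>f \<in> Ar C; g \<in> Ar C; Cod C f = Dom C g\<rbrakk>
    \<Longrightarrow> Comp E (op_arrow C f) (op_arrow C g) = op_arrow C (g \<cdot> f)"
  by (simp add: op_arrow_eq)

lemma op_arrow_eq_iff:
  "\<lbrakk>f \<in> Ar C; g \<in> Ar C\<rbrakk> \<Longrightarrow> op_arrow C f = op_arrow C g \<longleftrightarrow> f = g"
  by (auto simp: op_arrow_eq)

text \<open>Lifting \<open>h\<close> along \<open>g\<close> factors \<open>g\<close> as
  \<open>d \<cdot> c\<close>, and the chain \<open>Id, Id, c, d\<close> exhibits
  \<open>fib_inclusion C c\<close> as the composite.\<close>

lemma fib_inclusion_comp:
  assumes "g \<in> Ar C" "h \<in> Ar C" "Dom C h = fib0 C g"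
  shows "\<exists>c\<in>Ar C. Comp E (fib_inclusion C g) (fib_inclusion C h) = fib_inclusion C c"
proof -
  obtain c d where cd: "c \<in> Ar C" "d \<in> Ar C" "Cod C c = Dom C d" "g = d \<cdot> c" "h = fib1 C (c, d)"
    using assms by (metis fib_lift)
  then have "Comp E (fib_inclusion C g) (fib_inclusion C h) = fib_inclusion C c"
    using Comp_E[of "Id C (Dom C c)" "Id C (Dom C c)" c d] by (simp add: fib_inclusion_eq)
  with cd show ?thesis by blast
qed

lemma orthogonal_factorization_system_H:
  "orthogonal_factorization_system H (Active H) (Inert H)"
proof -
  have iso: "a \<in> Active H \<and> a \<in> Inert H" if "iso_arrow H a" for a
  proof -
    from that obtain x where x: "x \<in> Ob C" "a = Id E (obj C x)" by (auto simp: iso_E_iff)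
    then have "a = op_arrow C (Id C x)" "a = fib_inclusion C (tau C x)"
      by (simp_all add: op_arrow_eq fib_inclusion_eq)
    then show ?thesis using x(1) by (metis H_simps(7,8) Id_Ar tau_Ar image_eqI)
  qed
  have factor: "\<exists>l\<in>Active H. \<exists>r\<in>Inert H. Dom H r = Cod H l \<and> Comp H r l = e" if "e \<in> Ar H" for e
  proof -
    from that obtain f g where "e = sd_arrow C f g" and fg: "f \<in> Ar C" "g \<in> Ar C" "Cod C f = Dom C g"
      by (auto simp: Ar_E)
    then have "Comp E (fib_inclusion C (g \<cdot> f)) (op_arrow C (fib1 C (f, g))) = e"
      by (simp add: Comp_fib_inclusion_op_arrow)
    then show ?thesis using fg
      by (intro bexI[of _ "op_arrow C (fib1 C (f, g))"] bexI[of _ "fib_inclusion C (g \<cdot> f)"]) auto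
  qed
  have unique: "\<exists>!a. iso_arrow H a \<and> a \<in> hom H (Cod H l) (Cod H l') \<and> Comp H a l = l' \<and> Comp H r' a = r"
    if "l \<in> Active H" "r \<in> Inert H" "l' \<in> Active H" "r' \<in> Inert H"
      "Dom H r = Cod H l" "Dom H r' = Cod H l'" "Comp H r l = Comp H r' l'" for l r l' r'
  proof -
    from that(1-4) obtain f g f' g' where fg: "f \<in> Ar C" "g \<in> Ar C" "f' \<in> Ar C" "g' \<in> Ar C"
      and lr: "l = op_arrow C f" "r = fib_inclusion C g" "l' = op_arrow C f'" "r' = fib_inclusion C g'"
      by auto
    \<comment> \<open>The factorization is strictly unique, so the comparison can only be the
      identity \<open>?a\<close>.\<close>
    then have "g = g' \<and> f = f'" using that(5-7) by (intro fib_op_factorization_unique) auto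
    then have lr': "l' = l" "r' = r" using lr by simp_all
    let ?a = "Id E (obj C (Dom C f))"
    have "iso_arrow E ?a" using fg by (auto simp: iso_E_iff)
    moreover have "?a \<in> hom E (Cod E l) (Cod E l)" using fg by (simp add: hom_def lr)
    moreover have "Comp E ?a l = l" "Comp E r ?a = r"
      using Comp_E_Id[of l] Comp_E_Id[of r] fg that(5) by (simp_all add: lr del: Id_E)
    moreover have "a = ?a" if "iso_arrow E a" "a \<in> hom E (Cod E l) (Cod E l)" for a
      using iso_E_eq_Id[OF that(1)] that(2) fg by (simp add: hom_def lr)
    ultimately show ?thesis
      unfolding lr' iso_H hom_H H_simps by (intro ex1I[of _ ?a]) blast+
  qed
  have "Comp H q p \<in> Active H" if "p \<in> Active H" "q \<in> Active H" "Dom H q = Cod H p" for p q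
    using that by (auto simp: op_arrow_comp)
  moreover have "Comp H q p \<in> Inert H" if "p \<in> Inert H" "q \<in> Inert H" "Dom H q = Cod H p" for p q
    using that fib_inclusion_comp by (auto simp: image_iff)
  moreover have "Active H \<subseteq> Ar H" "Inert H \<subseteq> Ar H" by auto
  ultimately show ?thesis
    unfolding orthogonal_factorization_system_def using iso factor
    by (intro conjI ballI allI impI unique) (assumption | blast)+
qed

section \<open>Units and the associated operadic category\<close>

lemma is_unit_iff: "is_unit H e \<longleftrightarrow> e \<in> obj C ` Lt C"
proof
  assume unit: "is_unit H e"
  then obtain x where x: "x \<in> Ob C" "e = obj C x" by (auto simp: is_unit_def Ob_E)
  \<comment> \<open>The unit condition is tested on the active map given by \<open>tau C x\<close>:
    an inert section of it forces \<open>tau C x\<close> to be an identity.\<close>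
  then have "op_arrow C (tau C x) \<in> Active H" "Cod H (op_arrow C (tau C x)) = e" by auto
  with unit obtain s where s: "s \<in> Inert H" "s \<in> hom H e (Dom H (op_arrow C (tau C x)))"
    "Comp H (op_arrow C (tau C x)) s = Id H e"
    unfolding is_unit_def by metis
  then obtain g where g: "g \<in> Ar C" "s = fib_inclusion C g" by auto
  then have "Dom C g = Cod C (tau C x)" using s x by (simp add: hom_def)
  then have "Comp E (sd_arrow C (tau C x) (tau C (Cod C (tau C x)))) (fib_inclusion C g)
      = sd_arrow C (Id C (Dom C g) \<cdot> tau C x) g"
    unfolding fib_inclusion_eq[OF g(1)] using g(1) x(1) by (intro Comp_op_arrow) auto
  then have "tau C x = Id C x" using s(3) x g(2) \<open>Dom C g = Cod C (tau C x)\<close> by (simp add: op_arrow_eq)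
  then have "x \<in> Lt C" using x by (metis Cod_tau Cod_Id)
  then show "e \<in> obj C ` Lt C" using x by blast
next
  assume "e \<in> obj C ` Lt C"
  then obtain u where u: "u \<in> Lt C" "e = obj C u" by blast
  have "\<exists>!s. s \<in> Inert H \<and> s \<in> hom H e (Dom H f) \<and> Comp H f s = Id H e"
    if f: "f \<in> Active H" "Cod H f = e" for f
  proof -
    \<comment> \<open>An active map into \<open>obj C u\<close> comes from an arrow of
      \<open>C\<close> starting at \<open>u\<close>, so it is an identity and its only section is
      itself.\<close>
    from f obtain k where k: "k \<in> Ar C" "f = op_arrow C k" by auto
    then have "Dom C k = u" using f u by simp
    then have f': "f = Id E e" using from_Lt k u by (metis op_arrow_Id Lt_Ob)
    have Id: "Id E e \<in> hom E e e"
      using u by (simp add: hom_def)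
    have comp: "Comp E (Id E e) s = s" if "s \<in> hom E e e" for s
      using Comp_E_Id(2)[of s] that by (simp add: hom_def)
    have inert: "Id E e \<in> Inert H"
      using u by (auto simp: fib_inclusion_eq intro!: image_eqI[of _ _ "Id C u"])
    have Dom: "Dom E (Id E e) = e" using Id by (simp add: hom_def)
    show ?thesis
      unfolding f' H_simps(3,5,6) hom_H Dom using Id comp inert by metis
  qed
  then show "is_unit H e" using u by (auto simp: is_unit_def Ob_E)
qed

lemma isos_H: "iso_arrow H a \<Longrightarrow> a = Id H (Dom H a)"
  using iso_E_eq_Id by simp

text \<open>The domain of \<open>fib_inclusion C g\<close> is given by the fiber of
  \<open>g\<close>; if it is a unit, that fiber lies in \<open>Lt C\<close> and \<open>g\<close> is
  an identity.\<close>

lemma inert_from_unit_iff: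
  assumes "y \<in> Ob C"
  shows "i \<in> Inert H \<and> is_unit H (Dom H i) \<and> Cod H i = obj C y \<longleftrightarrow> i = fib_inclusion C (Id C y)"
proof
  assume i: "i \<in> Inert H \<and> is_unit H (Dom H i) \<and> Cod H i = obj C y"
  then obtain g where g: "g \<in> Ar C" "i = fib_inclusion C g" by auto
  then have "fib0 C g \<in> Lt C" "Dom C g = y" using i by (auto simp: is_unit_iff)
  then show "i = fib_inclusion C (Id C y)" using eq_Id_if_fib0_Lt g by metis
qed (use assms in \<open>auto simp: is_unit_iff\<close>)

lemma active_from_unit_iff:
  assumes "y \<in> Ob C"
  shows "f \<in> Active H \<and> is_unit H (Dom H f) \<and> Cod H f = obj C y \<longleftrightarrow> f = op_arrow C (tau C y)"
proof
  assume f: "f \<in> Active H \<and> is_unit H (Dom H f) \<and> Cod H f = obj C y"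
  then obtain g where g: "g \<in> Ar C" "f = op_arrow C g" by auto
  then have "Cod C g \<in> Lt C" "Dom C g = y" using f by (auto simp: is_unit_iff)
  then show "f = op_arrow C (tau C y)" using eq_tau g by metis
qed (use assms in \<open>auto simp: is_unit_iff\<close>)

section \<open>Cardinality and the hypermoment axioms\<close>

lemma Gamma_Id_1:
  "Id Gamma 1 \<in> hom Gamma 1 1" "Comp Gamma (Id Gamma 1) (Id Gamma 1) = Id Gamma 1"
  "Id Gamma 1 \<in> Gamma_active" "Id Gamma 1 \<in> Gamma_inert"
  by (auto simp: Gamma_def op_cat_def fin_pointed_def hom_def compose_def fun_eq_iff
      Gamma_active_def Gamma_inert_def Gamma_subset_def)

lemma inert_1_1_eq_Id:
  assumes "e \<in> Gamma_inert" "e \<in> hom Gamma 1 1"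
  shows "e = Id Gamma 1"
proof -
  from assms obtain f where e: "e = (1, 1, f)" and f: "f \<in> {0..1} \<rightarrow>\<^sub>E {0..1}" "f 0 = 0"
    by (auto simp: hom_def Gamma_def op_cat_def fin_pointed_def)
  from assms(1) obtain j where "Gamma_subset e 1 = {j}"
    by (auto simp: e Gamma_inert_def Gamma_def op_cat_def fin_pointed_def)
  then have "j \<in> Gamma_subset e 1" by simp
  then have "f 1 = 1" by (auto simp: e Gamma_subset_def)
  have "f t = restrict id {0..1} t" for t
  proof (cases "t \<in> {0..1}")
    case True
    then have "t = 0 \<or> t = 1" by auto
    then show ?thesis using \<open>f 1 = 1\<close> f(2) by auto
  next
    \<comment> \<open>Outside \<open>{0..1}\<close> both functions take the default value
      \<open>undefined\<close>.\<close>
    case False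
    then show ?thesis using PiE_arb[OF f(1)] by auto
  qed
  then show ?thesis by (auto simp: e Gamma_def op_cat_def fin_pointed_def)
qed

lemma hypermoment_category_H: "hypermoment_category H"
proof -
  have "cat_functor H Gamma (card0 H) (card1 H)"
    using Gamma_Id_1(1,2) unfolding cat_functor_def hom_def
    by (auto simp: Gamma_def op_cat_def fin_pointed_def)
  moreover have "essentially_unique H
      (\<lambda>i. i \<in> Inert H \<and> is_unit H (Dom H i) \<and> Cod H i = y \<and> card1 H i = e)"
    if y: "y \<in> Ob H" and e: "e \<in> Gamma_inert" "e \<in> hom Gamma 1 (card0 H y)" for y e
  proof -
    from y obtain x where x: "x \<in> Ob C" "y = obj C x" by (auto simp: Ob_E)
    \<comment> \<open>The only inert endomorphism of 1 in \<open>Gamma\<close> is the identity, so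
      the condition on cardinality holds for every \<open>i\<close>.\<close>
    have "card1 H i = e" for i using inert_1_1_eq_Id e by simp
    then have "(\<lambda>i. i \<in> Inert H \<and> is_unit H (Dom H i) \<and> Cod H i = y \<and> card1 H i = e)
        = (\<lambda>i. i = fib_inclusion C (Id C x))"
      using inert_from_unit_iff[OF x(1)] unfolding x(2) by blast
    then show ?thesis
      using essentially_unique_eq[OF category_H isos_H, of "fib_inclusion C (Id C x)"] x(1) by simp
  qed
  moreover have "card1 H f \<in> Gamma_active" "card1 H f \<in> Gamma_inert" for f
    using Gamma_Id_1 by simp_all
  ultimately show ?thesis
    unfolding hypermoment_category_def
    by (intro conjI ballI impI category_H orthogonal_factorization_system_H) blast+
qed

lemma unital_H: "unital H"
  unfolding unital_def
proof
  fix y assume "y \<in> Ob H"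
  then obtain x where x: "x \<in> Ob C" "y = obj C x" by (auto simp: Ob_E)
  have "(\<lambda>f. f \<in> Active H \<and> is_unit H (Dom H f) \<and> Cod H f = y)
      = (\<lambda>f. f = op_arrow C (tau C x))"
    unfolding x(2) by (intro ext active_from_unit_iff x(1))
  then show "essentially_unique H (\<lambda>f. f \<in> Active H \<and> is_unit H (Dom H f) \<and> Cod H f = y)"
    using essentially_unique_eq[OF category_H isos_H, of "op_arrow C (tau C x)"] x(1) by simp
qed

lemma rigid_H: "rigid H"
proof -
  have "Dom E a = Cod E a" if "iso_arrow E a" for a
    using that by (auto simp: iso_E_iff)
  moreover have "Comp E a f = f" if "f \<in> op_arrow C ` Ar C" "iso_arrow E a" "a \<in> hom E (Cod E f) (Cod E f)" for a f
  proof -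
    have "a = Id E (Cod E f)" using iso_E_eq_Id that by (metis (mono_tags, lifting) hom_def mem_Collect_eq)
    then show ?thesis using category_E that(1) unfolding category_def by auto
  qed
  ultimately show ?thesis by (simp add: rigid_def isos_are_automorphisms_def)
qed

section \<open>Fibers in the associated operadic category\<close>

lemma factorization_H:
  assumes "f \<in> Ar C" "g \<in> Ar C" "Dom C f = fib0 C g"
  shows "factorization H (Comp E (fib_inclusion C g) (op_arrow C f)) = (op_arrow C f, fib_inclusion C g)"
  unfolding factorization_def
\<comment> \<open>Strict uniqueness of the factorization leaves the choice operator a single
  candidate.\<close>
proof (rule some_equality)
  fix lr assume "case lr of (l, r) \<Rightarrow> l \<in> Active H \<and> r \<in> Inert H \<and> Dom H r = Cod H l \<and>
    Comp H r l = Comp E (fib_inclusion C g) (op_arrow C f)"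
  then obtain f' g' where "lr = (op_arrow C f', fib_inclusion C g')" "f' \<in> Ar C" "g' \<in> Ar C"
    "Dom C f' = fib0 C g'"
    "Comp E (fib_inclusion C g') (op_arrow C f') = Comp E (fib_inclusion C g) (op_arrow C f)"
    by auto
  with fib_op_factorization_unique[of g' f' g f] assms
  show "lr = (op_arrow C f, fib_inclusion C g)" by simp
qed (use assms in auto)

text \<open>Both sides are the arrow \<open>sd_arrow C g f\<close>. This exchange puts an inert map
  followed by an active one into active/inert form, from which fibers and their induced maps are
  read off.\<close>

lemma op_arrow_comp_fib_inclusion:
  assumes "g \<in> Ar C" "f \<in> Ar C" "Cod C g = Dom C f"
  shows "Comp E (op_arrow C g) (fib_inclusion C f)
    = Comp E (fib_inclusion C (f \<cdot> g)) (op_arrow C (fib1 C (g, f)))"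
  unfolding Comp_fib_inclusion_op_arrow[OF assms]
  using assms by (simp add: op_arrow_eq fib_inclusion_eq)

lemma fiber_inert_op_arrow:
  assumes "f \<in> Ar C"
  shows "fiber_inert H (op_arrow C f) = fib_inclusion C f"
proof -
  \<comment> \<open>The inert map from a unit is strictly unique, so its choice is forced as
    well.\<close>
  have "unit_inclusion H (Dom H (op_arrow C f)) = fib_inclusion C (Id C (Cod C f))"
    unfolding unit_inclusion_def using inert_from_unit_iff[of "Cod C f"] assms
    by (simp del: H_simps(7,8))
  then show ?thesis
    using assms op_arrow_comp_fib_inclusion[of f "Id C (Cod C f)"]
    by (simp add: fiber_inert_def inert_part_def factorization_H del: fib1_to_Id)
qed

lemma uop_isomorphism_H:
  "uop_isomorphism C (associated_operadic_category H) (obj C) (op_arrow C)"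
proof -
  let ?A = "associated_operadic_category H"
  have A: "Ob ?A = Ob E" "Ar ?A = op_arrow C ` Ar C" "Dom ?A = Cod E" "Cod ?A = Dom E" "Id ?A = Id E"
    "Comp ?A = (\<lambda>g f. Comp E f g)" "Lt ?A = obj C ` Lt C"
    "fib0 ?A = (\<lambda>f. Dom E (fiber_inert H f))"
    "fib1 ?A = (\<lambda>(g, f). active_part H (Comp E g (fiber_inert H f)))"
    by (simp_all add: associated_operadic_category_def active_op_def op_cat_def cat.defs uop.defs
        is_unit_iff)
  have "cat_functor C ?A (obj C) (op_arrow C)"
    unfolding cat_functor_def A by (auto simp: Ob_E op_arrow_Id op_arrow_comp)
  moreover have "bij_betw (obj C) (Ob C) (Ob ?A)" "bij_betw (op_arrow C) (Ar C) (Ar ?A)"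
    unfolding A by (auto simp: bij_betw_def inj_on_def Ob_E op_arrow_eq_iff)
  \<comment> \<open>The fiber of \<open>op_arrow C f\<close> is included by
    \<open>fib_inclusion C f\<close>; exchanging it with \<open>op_arrow C g\<close> leaves
    \<open>fib1 C (g, f)\<close> as the active part.\<close>
  moreover have "op_arrow C (fib1 C (g, f)) = fib1 ?A (op_arrow C g, op_arrow C f)"
    if "g \<in> Ar C" "f \<in> Ar C" "Cod C g = Dom C f" for g f
    unfolding A using that
    by (simp add: fiber_inert_op_arrow op_arrow_comp_fib_inclusion active_part_def factorization_H)
  ultimately show ?thesis
    unfolding uop_isomorphism_def cat_isomorphism_def
    using fiber_inert_op_arrow by (auto simp: A)
qed

end

theorem proposition10p9:
  fixes C :: "('o, 'a) uop"
  assumes "unary_operadic_category C"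
    and "blow_up_axiom C"
    and "isos_are_automorphisms C"
    and "\<forall>f\<in>Ar C. Dom C f \<in> Lt C \<longrightarrow> f = Id C (Dom C f)"
  shows "hypermoment_category (sdU_hypermoment C)
    \<and> unital (sdU_hypermoment C)
    \<and> rigid (sdU_hypermoment C)
    \<and> uop_isomorphism C (associated_operadic_category (sdU_hypermoment C)) (obj C) (op_arrow C)"
proof -
  interpret blow_up_rigid C
    using assms by unfold_locales auto
  show ?thesis
    using hypermoment_category_H unital_H rigid_H uop_isomorphism_H by blast
qed

end
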